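(* Consider the step-size adaptive evolution strategy (SSA-ES) described in the context, solving a spherical function $f(x)=\nu(\|x-x^*\|)$ on $\mathbb{R}^d$, where $\nu:\mathbb{R}\to\mathbb{R}$ is an arbitrary strictly increasing function. Suppose that $w_1,\dots,w_\lambda$ satisfy: (W1) $w_i\ge0$ for all $i=1,\dots,\lambda$ and $\sum_{i=1}^\lambda w_i=1$; (W2) $w_1\ge\cdots\ge w_\lambda\ge0$ and $w_i>w_{i+1}$ for at least one $i$; (W3) $\bar C_\sigma:=\int_{\mathbb{R}}u(\Phi(z))(z^2-1)\psi(z)\,\mathrm{d}z>0$, where $\psi$ and $\Phi$ are the probability density function and the cumulative distribution function of the standard normal distribution. Let $\Psi(\theta)=V(\theta)^{1/2}\max(\eta,\xi(\theta))^{1/2}$ with $V(\theta)=\|m-x^*\|^2+d\sigma^2$, $\xi(\theta)=\|m-x^*\|/\sigma$, and with $\eta>0$ the constant specified in the context. Then there exists $\bar\alpha>0$ such that $$\limsup_{n\to\infty}\frac1n\ln\big(\mathbb{E}_0[\Psi(\theta_n)]\big)<0$$ for any $\theta_0\in\Theta$ and any $\alpha\in(0,\bar\alpha]$. That is, $$\limsup_{n\to\infty}\frac1n\ln\big(\mathbb{E}_0[\|X_n-x^*\|]\big)<0,$$ where $X_n\sim P_{\theta_n}$.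
   Context: Let $d\ge1$, $\lambda\ge2$, $x^*\in\mathbb{R}^d$, $\Theta=\mathbb{R}^d\times(0,\infty)$, $\theta=(m,\sigma)\in\Theta$, and let $P_\theta=\mathcal{N}(m,\sigma^2I)$ be the Gaussian distribution on $\mathbb{R}^d$. For weights $w_1\ge\dots\ge w_\lambda$ and $x_1,\dots,x_\lambda\in\mathbb{R}^d$ define $$W(i;x_1,\dots,x_\lambda)=\sum_{j=k_i}^{k_i+l_i}\frac{w_{j+1}}{l_i+1},\quad k_i=\#\{j\ne i:f(x_j)<f(x_i)\},\quad l_i=\#\{j\neq i:f(x_j)=f(x_i)\}.$$ SSA-ES with step-size $\alpha>0$: at iteration $n$, given $\theta_n=(m_n,\sigma_n)$, sample $x_{n,1},\dots,x_{n,\lambda}$ independently from $P_{\theta_n}$ and set $\theta_{n+1}=\theta_n+\alpha F_n$ with $$F_n=\sum_{i=1}^\lambda W(i;x_{n,1},\dots,x_{n,\lambda})\,g(x_{n,i};\theta_n),\qquad g(x;\theta)=\Big(x-m,\ \tfrac{1}{2d\sigma}\big(\|x-m\|^2-d\sigma^2\big)\Big).$$ The initial parameter $\theta_0$ is deterministic and $\mathbb{E}_0$ is the conditional expectation given $\theta_0$. $X_n$ is a random vector distributed according to $P_{\theta_n}$ conditionally on $\theta_n$. Under (W1), $\{\theta_n\}$ never leaves $\Theta$ for $\alpha<2$; step-sizes are understood to be in this range. The mean field is $F(\theta)=\mathbb{E}[F_n\mid\theta_n=\theta]=\int u(q_\theta^<(f(x)))\,g(x;\theta)\,P_\theta(\mathrm{d}x)$,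 where $q^<_\theta(s)=\Pr_{x\sim P_\theta}[f(x)<s]$ and $$u(p)=\sum_{k=0}^{\lambda-1}w_{k+1}\,\lambda\binom{\lambda-1}{k}p^k(1-p)^{\lambda-1-k},\qquad p\in[0,1].$$ The constant $\eta$: fix some $C_\sigma\in(0,\bar C_\sigma)$; $\eta>0$ is a constant such that $\langle\nabla\xi(\theta),F(\theta)\rangle<-(C_\sigma/(2d))\,\xi(\theta)$ for every $\theta\in\Theta$ with $\xi(\theta)\ge\eta$ (such $\eta$ exists under (W2) and (W3)). Here $\nabla$ is the gradient with respect to $\theta=(m,\sigma)$. *)

theory Defs
  imports "HOL-Probability.Probability"
begin

text \<open>
  The search space is \<^typ>\<open>real ^ 'n\<close>, so its dimension is \<open>d = CARD('n)\<close>. A parameter is a pair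
  \<open>\<theta> = (m, \<sigma>)\<close>. Weights and samples are sequences of which only the indices \<open>1, \<dots>, \<lambda>\<close> matter.
\<close>

definition param_space :: "((real ^ 'n) \<times> real) set" where
  "param_space = UNIV \<times> {0<..}"

text \<open>The density of \<open>N(m, \<sigma>\<^sup>2 I)\<close> is the product of the densities of its coordinates.\<close>

definition gauss :: "(real ^ 'n) \<times> real \<Rightarrow> (real ^ 'n) measure" where
  "gauss \<theta> = density lborel
     (\<lambda>x. ennreal (\<Prod>i\<in>UNIV. normal_density (fst \<theta> $ i) (snd \<theta>) (x $ i)))"

definition num_better :: "('a \<Rightarrow> real) \<Rightarrow> nat \<Rightarrow> (nat \<Rightarrow> 'a) \<Rightarrow> nat \<Rightarrow> nat" where
  "num_better f lam x i = card {j \<in> {1..lam}. j \<noteq> i \<and> f (x j) < f (x i)}"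

definition num_tied :: "('a \<Rightarrow> real) \<Rightarrow> nat \<Rightarrow> (nat \<Rightarrow> 'a) \<Rightarrow> nat \<Rightarrow> nat" where
  "num_tied f lam x i = card {j \<in> {1..lam}. j \<noteq> i \<and> f (x j) = f (x i)}"

definition rank_weight ::
  "('a \<Rightarrow> real) \<Rightarrow> (nat \<Rightarrow> real) \<Rightarrow> nat \<Rightarrow> (nat \<Rightarrow> 'a) \<Rightarrow> nat \<Rightarrow> real" where
  "rank_weight f w lam x i =
     (let k = num_better f lam x i; l = num_tied f lam x i
      in \<Sum>j = k..k + l. w (j + 1) / real (l + 1))"

definition search_dir :: "(real ^ 'n) \<times> real \<Rightarrow> real ^ 'n \<Rightarrow> (real ^ 'n) \<times> real" where
  "search_dir \<theta> x = (let m = fst \<theta>; \<sigma> = snd \<theta>; d = real CARD('n)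
     in (x - m, 1 / (2 * d * \<sigma>) * ((norm (x - m))\<^sup>2 - d * \<sigma>\<^sup>2)))"

definition increment ::
  "(real ^ 'n \<Rightarrow> real) \<Rightarrow> (nat \<Rightarrow> real) \<Rightarrow> nat \<Rightarrow> (real ^ 'n) \<times> real \<Rightarrow> (nat \<Rightarrow> real ^ 'n)
     \<Rightarrow> (real ^ 'n) \<times> real" where
  "increment f w lam \<theta> x = (\<Sum>i = 1..lam. rank_weight f w lam x i *\<^sub>R search_dir \<theta> (x i))"

definition samples :: "nat \<Rightarrow> (real ^ 'n) \<times> real \<Rightarrow> (nat \<Rightarrow> real ^ 'n) measure" where
  "samples lam \<theta> = (\<Pi>\<^sub>M i\<in>{1..lam}. gauss \<theta>)"

text \<open>
  The algorithm is the Markov chain whose transition kernel is \<open>ssa_kernel\<close>; \<open>ssa_law \<dots> n\<close> is the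
  law of \<open>\<theta>\<^sub>n\<close> given the deterministic \<open>\<theta>\<^sub>0\<close>, and \<open>ssa_sample_law \<dots> n\<close> that of \<open>X\<^sub>n\<close>.
  For Borel measurable \<open>f\<close> both kernels are measurable into \<^const>\<open>subprob_algebra\<close>: at \<open>\<sigma> = 0\<close>, where
  \<^const>\<open>normal_density\<close> is constantly 0, they are null measures, and elsewhere probability
  measures. For nonnegative weights of sum 1, \<open>\<alpha> < 2\<close> and \<open>\<theta>\<^sub>0\<close> in \<^const>\<open>param_space\<close>, only their
  values on \<^const>\<open>param_space\<close> matter.
\<close>

definition ssa_kernel ::
  "(real ^ 'n \<Rightarrow> real) \<Rightarrow> (nat \<Rightarrow> real) \<Rightarrow> nat \<Rightarrow> real \<Rightarrow> (real ^ 'n) \<times> real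
     \<Rightarrow> ((real ^ 'n) \<times> real) measure" where
  "ssa_kernel f w lam \<alpha> \<theta> =
     distr (samples lam \<theta>) borel (\<lambda>x. \<theta> + \<alpha> *\<^sub>R increment f w lam \<theta> x)"

primrec ssa_law ::
  "(real ^ 'n \<Rightarrow> real) \<Rightarrow> (nat \<Rightarrow> real) \<Rightarrow> nat \<Rightarrow> real \<Rightarrow> (real ^ 'n) \<times> real \<Rightarrow> nat
     \<Rightarrow> ((real ^ 'n) \<times> real) measure" where
  "ssa_law f w lam \<alpha> \<theta>\<^sub>0 0 = return borel \<theta>\<^sub>0"
| "ssa_law f w lam \<alpha> \<theta>\<^sub>0 (Suc n) = ssa_law f w lam \<alpha> \<theta>\<^sub>0 n \<bind> ssa_kernel f w lam \<alpha>"

definition ssa_sample_law ::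
  "(real ^ 'n \<Rightarrow> real) \<Rightarrow> (nat \<Rightarrow> real) \<Rightarrow> nat \<Rightarrow> real \<Rightarrow> (real ^ 'n) \<times> real \<Rightarrow> nat
     \<Rightarrow> (real ^ 'n) measure" where
  "ssa_sample_law f w lam \<alpha> \<theta>\<^sub>0 n = ssa_law f w lam \<alpha> \<theta>\<^sub>0 n \<bind> gauss"

text \<open>\<open>F(\<theta>) = E[F\<^sub>n | \<theta>\<^sub>n = \<theta>]\<close>.\<close>

definition mean_field ::
  "(real ^ 'n \<Rightarrow> real) \<Rightarrow> (nat \<Rightarrow> real) \<Rightarrow> nat \<Rightarrow> (real ^ 'n) \<times> real \<Rightarrow> (real ^ 'n) \<times> real" where
  "mean_field f w lam \<theta> = (\<integral>x. increment f w lam \<theta> x \<partial>samples lam \<theta>)"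

text \<open>The function \<open>u\<close> on \<open>[0, 1]\<close> that enters the condition on \<open>C\<^sub>\<sigma>\<close>.\<close>

definition weight_fun :: "(nat \<Rightarrow> real) \<Rightarrow> nat \<Rightarrow> real \<Rightarrow> real" where
  "weight_fun w lam p =
     (\<Sum>k = 0..lam - 1. w (k + 1) * real lam * real ((lam - 1) choose k)
        * p ^ k * (1 - p) ^ (lam - 1 - k))"

definition C_sigma_bar :: "(nat \<Rightarrow> real) \<Rightarrow> nat \<Rightarrow> real" where
  "C_sigma_bar w lam =
     (\<integral>z. weight_fun w lam (cdf std_normal_distribution z) * (z\<^sup>2 - 1) * std_normal_density z
        \<partial>lborel)"

definition V :: "real ^ 'n \<Rightarrow> (real ^ 'n) \<times> real \<Rightarrow> real" where
  "V xs \<theta> = (norm (fst \<theta> - xs))\<^sup>2 + real CARD('n) * (snd \<theta>)\<^sup>2"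

definition xi :: "real ^ 'n \<Rightarrow> (real ^ 'n) \<times> real \<Rightarrow> real" where
  "xi xs \<theta> = norm (fst \<theta> - xs) / snd \<theta>"

definition Psi :: "real ^ 'n \<Rightarrow> real \<Rightarrow> (real ^ 'n) \<times> real \<Rightarrow> real" where
  "Psi xs \<eta> \<theta> = sqrt (V xs \<theta>) * sqrt (max \<eta> (xi xs \<theta>))"

text \<open>
  The gradient with respect to the canonical inner product, here that of \<open>\<real>\<^sup>d \<times> \<real>\<close>. It is only
  meaningful where the function is differentiable; \<^const>\<open>xi\<close> is, wherever it is positive on
  \<^const>\<open>param_space\<close>.
\<close>

definition gradient :: "('a::real_inner \<Rightarrow> real) \<Rightarrow> 'a \<Rightarrow> 'a" where
  "gradient h a = (THE D. GDERIV h a :> D)"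

end

theory Submission
  imports Defs
begin

text \<open>
The strategy is invariant under translations and under scaling about the optimum \<open>x\<^sup>*\<close>: with
\<open>\<mu> = (m - x\<^sup>*) / \<sigma>\<close> and standard Gaussian samples \<open>z\<^sub>i = (x\<^sub>i - m) / \<sigma>\<close>, one step reads
\<open>\<mu> + \<alpha> a\<close> for the mean and \<open>1 + \<alpha> b\<close> for the step-size, both in units of \<open>\<sigma>\<close>, where the weights
behind \<open>a\<close> and \<open>b\<close> rank the samples by \<open>\<parallel>\<mu> + z\<^sub>i\<parallel>\<close>.

The function \<open>\<Psi>\<close> has a kink at \<open>\<xi> = \<eta>\<close>, and there a single step may increase its expectation however
small \<open>\<alpha>\<close> is, because the random part of a step is of order \<open>\<alpha>\<close> just as its mean. The proof uses the
smooth function \<open>L = V (1 + \<epsilon> \<xi>\<^sup>2)\<close> instead. It satisfies \<open>\<Psi>\<^sup>2 \<le> K L\<close> and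
\<open>E \<parallel>X\<^sub>n - x\<^sup>*\<parallel>\<^sup>2 = E V(\<theta>\<^sub>n) \<le> E L(\<theta>\<^sub>n)\<close>. So if one step multiplies the expectation of \<open>L\<close> by at most
\<open>\<rho> < 1\<close>, then \<open>E g \<le> sqrt (E g\<^sup>2)\<close> turns the decay \<open>\<rho>\<^sup>n\<close> of \<open>E L(\<theta>\<^sub>n)\<close> into the rate \<open>ln \<rho> / 2 < 0\<close> for
both expectations.

One step changes \<open>L\<close> by \<open>\<alpha>\<close> times a first-order term, up to an error of at most \<open>86 \<alpha>\<^sup>2 L T\<^sup>7\<close>, where
\<open>T = 1 + \<Sum>\<^sub>i \<parallel>z\<^sub>i\<parallel>\<^sup>2\<close> has moments of all orders (\<open>lyapunov_step_expansion\<close>). For small \<open>\<alpha>\<close> it is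
enough that the expected first-order term is at most \<open>- \<kappa> L\<close> with \<open>\<kappa> > 0\<close> (\<open>first_order_drift\<close>). It
is made of the drifts of \<open>V\<close> and of \<open>\<xi>\<^sup>2\<close>.

The drift of \<open>V\<close> is the expectation of \<open>\<Sum>\<^sub>i W\<^sub>i \<parallel>\<mu> + z\<^sub>i\<parallel>\<^sup>2\<close> minus that of \<open>\<parallel>\<mu> + z\<^sub>1\<parallel>\<^sup>2\<close>. Closer samples
never get smaller weights, so Chebyshev's sum inequality makes it nonpositive for every \<open>\<mu>\<close>. It is bounded away
from 0 for \<open>\<parallel>\<mu>\<parallel> \<le> \<eta>\<close>: with a probability that does not depend on \<open>\<mu>\<close>, one sample is better than all
others by a fixed margin, and this sample receives more than the average weight \<open>1 / \<lambda>\<close>.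

If \<open>\<parallel>\<mu>\<parallel> \<ge> \<eta>\<close>, the defining property of \<open>\<eta>\<close> says that \<open>\<xi>\<^sup>2\<close> decreases at a fixed relative rate, and \<open>V\<close>
does not increase. If \<open>\<parallel>\<mu>\<parallel> < \<eta>\<close>, then \<open>V\<close> decreases at a fixed relative rate, while the growth of \<open>\<xi>\<^sup>2\<close>
is bounded and enters with the factor \<open>\<epsilon>\<close>, so that a small \<open>\<epsilon>\<close> keeps the sum negative.
\<close>

section \<open>Rank-based weights\<close>

text \<open>
The weight \<open>W(i; \<dots>)\<close> for samples indexed by an arbitrary finite set, so that it can be analysed by
removing a class of tied samples.
\<close>

definition tie_weight :: "'i set \<Rightarrow> (nat \<Rightarrow> real) \<Rightarrow> ('i \<Rightarrow> real) \<Rightarrow> 'i \<Rightarrow> real" where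
  "tie_weight S w Y i =
     (let k = card {j\<in>S. j \<noteq> i \<and> Y j < Y i}; l = card {j\<in>S. j \<noteq> i \<and> Y j = Y i}
      in \<Sum>j = k..k + l. w (j + 1) / real (l + 1))"

lemma rank_weight_eq_tie_weight:
  "rank_weight f w lam x i = tie_weight {1..lam} w (\<lambda>j. f (x j)) i"
  by (simp add: rank_weight_def tie_weight_def num_better_def num_tied_def)

text \<open>
Only the order of the objective values matters; this is why \<open>\<nu>\<close> disappears from the analysis, and
why the ranking may use the normalised distances \<open>\<parallel>\<mu> + z\<^sub>i\<parallel>\<close>.
\<close>

lemma tie_weight_strict_mono_comp:
  assumes "\<And>a b. h a < h b \<longleftrightarrow> Y a < Y b"
  shows "tie_weight S w h = tie_weight S w Y"
proof -
  have "h a = h b \<longleftrightarrow> Y a = Y b" for a b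
    using assms[of a b] assms[of b a] by (metis linorder_neqE_linordered_idom order_less_irrefl)
  then show ?thesis by (auto simp: tie_weight_def assms fun_eq_iff)
qed

lemma tie_weight_cong:
  "i \<in> S \<Longrightarrow> (\<And>j. j \<in> S \<Longrightarrow> Y j = Y' j) \<Longrightarrow> tie_weight S w Y i = tie_weight S w Y' i"
proof -
  assume "i \<in> S" and eq: "\<And>j. j \<in> S \<Longrightarrow> Y j = Y' j"
  then have "{j\<in>S. j \<noteq> i \<and> Y j < Y i} = {j\<in>S. j \<noteq> i \<and> Y' j < Y' i}"
    "{j\<in>S. j \<noteq> i \<and> Y j = Y i} = {j\<in>S. j \<noteq> i \<and> Y' j = Y' i}" by auto
  then show ?thesis by (simp add: tie_weight_def)
qed

text \<open>
A class of \<open>p\<close> tied samples behind \<open>k\<close> better ones shares \<open>w\<^sub>k\<^sub>+\<^sub>1 + \<dots> + w\<^sub>k\<^sub>+\<^sub>p\<close> equally. Removing the worst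
class changes neither \<open>k\<close> nor \<open>l\<close> for the remaining samples, which gives an induction on the number
of samples.
\<close>

lemma sum_tie_weight:
  assumes "finite S"
  shows "(\<Sum>i\<in>S. tie_weight S w Y i) = (\<Sum>j = 1..card S. w j)"
  using assms
proof (induction "card S" arbitrary: S rule: less_induct)
  case less
  show ?case
  proof (cases "S = {}")
    case False
    define y where "y = Max (Y ` S)"
    \<comment> \<open>The worst class of ties, to be removed.\<close>
    define M where "M = {i\<in>S. Y i = y}"
    define S' where "S' = {i\<in>S. Y i < y}"
    have le: "Y i \<le> y" if "i \<in> S" for i using that less.prems by (simp add: y_def)
    have S: "S = S' \<union> M" "S' \<inter> M = {}" using le by (auto simp: S'_def M_def order.order_iff_strict)
    have fin: "finite S'" "finite M" using less.prems by (auto simp: S'_def M_def)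
    have "y \<in> Y ` S" using False less.prems unfolding y_def by (intro Max_in) auto
    then have ne: "M \<noteq> {}" by (auto simp: M_def)
    then have cM: "card M > 0" using fin by (simp add: card_gt_0_iff)
    have cS: "card S = card S' + card M" using S fin by (simp add: card_Un_disjoint)
    have "tie_weight S w Y i = tie_weight S' w Y i" if "i \<in> S'" for i
    proof -
      have "{j\<in>S. j \<noteq> i \<and> Y j < Y i} = {j\<in>S'. j \<noteq> i \<and> Y j < Y i}"
        "{j\<in>S. j \<noteq> i \<and> Y j = Y i} = {j\<in>S'. j \<noteq> i \<and> Y j = Y i}"
        using that by (auto simp: S'_def)
      then show ?thesis by (simp add: tie_weight_def)
    qed
    then have "(\<Sum>i\<in>S'. tie_weight S w Y i) = (\<Sum>i\<in>S'. tie_weight S' w Y i)" by simp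
    also have "\<dots> = (\<Sum>j = 1..card S'. w j)"
      using fin cS cM by (intro less.hyps) auto
    finally have 1: "(\<Sum>i\<in>S'. tie_weight S w Y i) = (\<Sum>j = 1..card S'. w j)" .
    have "tie_weight S w Y i = (\<Sum>j = card S' + 1..card S. w j) / card M" if "i \<in> M" for i
    proof -
      have "{j\<in>S. j \<noteq> i \<and> Y j < Y i} = S'" "{j\<in>S. j \<noteq> i \<and> Y j = Y i} = M - {i}"
        using that by (auto simp: S'_def M_def)
      then have "tie_weight S w Y i = (\<Sum>j = card S'..card S' + (card M - 1). w (j + 1) / real (card M))"
        using that cM fin by (simp add: tie_weight_def Let_def)
      also have "\<dots> = (\<Sum>j = card S' + 1..card S' + (card M - 1) + 1. w j / real (card M))"
        using sum.shift_bounds_cl_nat_ivl[of "\<lambda>j. w j / real (card M)" "card S'" 1 "card S' + (card M - 1)"]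
        by simp
      finally show ?thesis using cM by (simp add: cS sum_divide_distrib)
    qed
    then have "(\<Sum>i\<in>M. tie_weight S w Y i) = (\<Sum>j = card S' + 1..card S. w j)"
      using cM by simp
    moreover have "(\<Sum>i\<in>S. tie_weight S w Y i) = (\<Sum>i\<in>S'. tie_weight S w Y i) + (\<Sum>i\<in>M. tie_weight S w Y i)"
      using S fin by (subst S(1), subst sum.union_disjoint) auto
    moreover have "(\<Sum>j = 1..card S. w j) = (\<Sum>j = 1..card S'. w j) + (\<Sum>j = card S' + 1..card S. w j)"
      by (subst sum.ub_add_nat[of 1 "card S'" w "card M", folded cS]) auto
    ultimately show ?thesis using 1 by simp
  qed simp
qed

lemma card_better_plus_tied:
  fixes Y :: "'i \<Rightarrow> real"
  assumes "finite S" "i \<in> S"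
  shows "card {j\<in>S. j \<noteq> i \<and> Y j < Y i} + card {j\<in>S. j \<noteq> i \<and> Y j = Y i} + 1
          = card {j\<in>S. Y j \<le> Y i}"
proof -
  let ?A = "{j\<in>S. j \<noteq> i \<and> Y j < Y i}" and ?B = "{j\<in>S. j \<noteq> i \<and> Y j = Y i}"
  have fin: "finite ?A" "finite ?B" using assms(1) by auto
  have "{j\<in>S. Y j \<le> Y i} = insert i (?A \<union> ?B)"
    using assms(2) by (auto simp: less_le)
  moreover have "card (insert i (?A \<union> ?B)) = Suc (card (?A \<union> ?B))"
    using fin by (intro card_insert_disjoint) auto
  moreover have "card (?A \<union> ?B) = card ?A + card ?B"
    using fin by (intro card_Un_disjoint) auto
  ultimately show ?thesis by presburger
qed

lemma tie_weight_nonneg: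
  assumes "finite S" "i \<in> S" and "\<And>j. j \<in> {1..card S} \<Longrightarrow> w j \<ge> 0"
  shows "tie_weight S w Y i \<ge> 0"
proof -
  have "card {j\<in>S. Y j \<le> Y i} \<le> card S" using assms by (intro card_mono) auto
  then show ?thesis using card_better_plus_tied[OF assms(1,2), of Y]
    unfolding tie_weight_def Let_def by (intro sum_nonneg divide_nonneg_nonneg assms(3)) auto
qed

text \<open>
The ranks occupied by the tie class of \<open>i\<close> all precede those of the tie class of \<open>j\<close>, so the smallest
weight averaged for \<open>i\<close> is at least the largest one averaged for \<open>j\<close>.
\<close>

lemma tie_weight_antimono:
  assumes S: "finite S" "i \<in> S" "j \<in> S"
    and w: "\<And>p q. 1 \<le> p \<Longrightarrow> p \<le> q \<Longrightarrow> q \<le> card S \<Longrightarrow> w q \<le> w p"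
    and less: "Y i < Y j"
  shows "tie_weight S w Y j \<le> tie_weight S w Y i"
proof -
  let ?k = "\<lambda>i. card {j\<in>S. j \<noteq> i \<and> Y j < Y i}" and ?l = "\<lambda>i. card {j\<in>S. j \<noteq> i \<and> Y j = Y i}"
  have le: "card {j\<in>S. Y j \<le> Y t} \<le> card S" for t using S by (intro card_mono) auto
  note bnd = card_better_plus_tied[OF S(1,2), of Y] card_better_plus_tied[OF S(1,3), of Y]
  have "card {j\<in>S. Y j \<le> Y i} \<le> ?k j" using S less by (intro card_mono) auto
  then have kj: "?k i + ?l i + 1 \<le> ?k j" using bnd by simp
  have "tie_weight S w Y j \<le> (\<Sum>t = ?k j..?k j + ?l j. w (?k j + 1) / real (?l j + 1))"
    unfolding tie_weight_def Let_def using bnd le[of j]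
    by (intro sum_mono divide_right_mono w) auto
  also have "\<dots> = w (?k j + 1)" by (simp add: field_simps)
  also have "\<dots> \<le> w (?k i + ?l i + 1)" using kj bnd le[of j] by (intro w) auto
  also have "\<dots> = (\<Sum>t = ?k i..?k i + ?l i. w (?k i + ?l i + 1) / real (?l i + 1))" by (simp add: field_simps)
  also have "\<dots> \<le> tie_weight S w Y i"
    unfolding tie_weight_def Let_def using bnd le[of i]
    by (intro sum_mono divide_right_mono w) auto
  finally show ?thesis .
qed

lemma tie_weight_best:
  fixes Y :: "'i \<Rightarrow> real"
  assumes "\<And>j. j \<in> S \<Longrightarrow> j \<noteq> i \<Longrightarrow> Y i < Y j"
  shows "tie_weight S w Y i = w 1"
proof -
  have "\<not> Y j < Y i" "Y j \<noteq> Y i" if "j \<in> S" "j \<noteq> i" for j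
    using assms[OF that] by auto
  then have *: "{j\<in>S. j \<noteq> i \<and> Y j < Y i} = {}" "{j\<in>S. j \<noteq> i \<and> Y j = Y i} = {}"
    by blast+
  show ?thesis unfolding tie_weight_def * by simp
qed

text \<open>
The identity behind Chebyshev's sum inequality: if \<open>a\<close> decreases as \<open>y\<close> increases, every term on the
left is nonnegative.
\<close>

lemma sum_pairwise_diff_mult:
  fixes a y :: "'i \<Rightarrow> real"
  shows "(\<Sum>i\<in>S. \<Sum>j\<in>S. (a i - a j) * (y j - y i))
       = 2 * ((\<Sum>i\<in>S. a i) * (\<Sum>i\<in>S. y i) - card S * (\<Sum>i\<in>S. a i * y i))"
proof -
  have "(\<Sum>i\<in>S. \<Sum>j\<in>S. (a i - a j) * (y j - y i))
      = (\<Sum>i\<in>S. \<Sum>j\<in>S. a i * y j) + (\<Sum>i\<in>S. \<Sum>j\<in>S. a j * y i)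
        - (\<Sum>i\<in>S. \<Sum>j\<in>S. a i * y i) - (\<Sum>i\<in>S. \<Sum>j\<in>S. a j * y j)"
    by (simp add: left_diff_distrib right_diff_distrib sum.distrib sum_subtractf)
  moreover have "(\<Sum>i\<in>S. \<Sum>j\<in>S. a j * y i) = (\<Sum>i\<in>S. \<Sum>j\<in>S. a i * y j)"
    by (rule sum.swap)
  moreover have "(\<Sum>i\<in>S. \<Sum>j\<in>S. a i * y i) = card S * (\<Sum>i\<in>S. a i * y i)"
    by (simp add: sum_distrib_left)
  moreover have "(\<Sum>i\<in>S. \<Sum>j\<in>S. a j * y j) = card S * (\<Sum>i\<in>S. a i * y i)"
    by simp
  moreover have "p = 2 * (q - r)" if "p = q + q' - r1 - r2" "q' = q" "r1 = r" "r2 = r"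
    for p q r q' r1 r2 :: real
    using that by simp
  ultimately show ?thesis unfolding sum_product by blast
qed

lemma antimono_diff_mult_nonneg:
  fixes a y :: "'i \<Rightarrow> real"
  assumes "y i < y j \<Longrightarrow> a j \<le> a i" "y j < y i \<Longrightarrow> a i \<le> a j"
  shows "0 \<le> (a i - a j) * (y j - y i)"
  using assms by (cases "y i" "y j" rule: linorder_cases)
    (auto intro: mult_nonneg_nonneg mult_nonpos_nonpos)

lemma chebyshev_sum:
  fixes a y :: "'i \<Rightarrow> real"
  assumes "\<And>i j. i \<in> S \<Longrightarrow> j \<in> S \<Longrightarrow> y i < y j \<Longrightarrow> a j \<le> a i"
  shows "card S * (\<Sum>i\<in>S. a i * y i) \<le> (\<Sum>i\<in>S. a i) * (\<Sum>i\<in>S. y i)"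
proof -
  have "0 \<le> (\<Sum>i\<in>S. \<Sum>j\<in>S. (a i - a j) * (y j - y i))"
    by (intro sum_nonneg antimono_diff_mult_nonneg) (simp_all add: assms)
  then show ?thesis by (simp add: sum_pairwise_diff_mult)
qed

text \<open>
A quantitative form for the case that \<open>t\<close> has the smallest value with margin \<open>g\<close>: the row \<open>t\<close> of the
double sum alone contributes at least \<open>g (n a\<^sub>t - \<Sum>\<^sub>i a\<^sub>i)\<close>.
\<close>

lemma chebyshev_sum_gap:
  fixes a y :: "'i \<Rightarrow> real"
  assumes S: "finite S" "t \<in> S"
    and anti: "\<And>i j. i \<in> S \<Longrightarrow> j \<in> S \<Longrightarrow> y i < y j \<Longrightarrow> a j \<le> a i"
    and gap: "g > 0" "\<And>j. j \<in> S \<Longrightarrow> j \<noteq> t \<Longrightarrow> y j \<ge> y t + g"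
  shows "card S * (\<Sum>i\<in>S. a i * y i) \<le> (\<Sum>i\<in>S. a i) * (\<Sum>i\<in>S. y i)
          - g / 2 * (card S * a t - (\<Sum>i\<in>S. a i))"
proof -
  have "g * (card S * a t - (\<Sum>i\<in>S. a i)) = (\<Sum>j\<in>S. (a t - a j) * g)"
    by (simp add: left_diff_distrib sum_subtractf sum_distrib_right) (simp add: algebra_simps sum_distrib_left)
  also have "\<dots> \<le> (\<Sum>j\<in>S. (a t - a j) * (y j - y t))"
  proof (intro sum_mono)
    fix j assume "j \<in> S"
    then show "(a t - a j) * g \<le> (a t - a j) * (y j - y t)"
      using gap(1) gap(2)[of j] anti[of t j] S by (cases "j = t") (auto intro!: mult_left_mono)
  qed
  also have "\<dots> \<le> (\<Sum>i\<in>S. \<Sum>j\<in>S. (a i - a j) * (y j - y i))"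
    using S anti by (intro member_le_sum[where f="\<lambda>i. \<Sum>j\<in>S. (a i - a j) * (y j - y i)"]
        sum_nonneg antimono_diff_mult_nonneg) auto
  finally show ?thesis unfolding sum_pairwise_diff_mult by (simp add: left_diff_distrib)
qed

section \<open>The Gaussian sampling distribution\<close>

text \<open>
Fubini for products of functions of single coordinates; the index of a coordinate is recovered from
its unit vector.
\<close>

lemma nn_integral_lborel_vec_prod:
  fixes f :: "'n::finite \<Rightarrow> real \<Rightarrow> ennreal"
  assumes [measurable]: "\<And>i. f i \<in> borel_measurable borel"
  shows "(\<integral>\<^sup>+x. (\<Prod>i\<in>UNIV. f i (x $ i)) \<partial>(lborel :: (real ^ 'n) measure)) = (\<Prod>i\<in>UNIV. \<integral>\<^sup>+t. f i t \<partial>lborel)"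
proof -
  let ?e = "\<lambda>i::'n. axis i (1::real)"
  have inj: "inj ?e" by (auto simp: inj_on_def axis_eq_axis)
  have Basis: "(Basis :: (real ^ 'n) set) = range ?e" by (auto simp: Basis_vec_def)
  define F where "F = (\<lambda>b. f (inv ?e b))"
  have F: "F (?e i) = f i" for i unfolding F_def by (subst inv_f_f[OF inj]) simp
  have "(\<integral>\<^sup>+x. (\<Prod>b\<in>Basis. F b (x \<bullet> b)) \<partial>(lborel :: (real ^ 'n) measure)) = (\<Prod>b\<in>Basis. \<integral>\<^sup>+t. F b t \<partial>lborel)"
    by (rule nn_integral_lborel_prod) (auto simp: F_def)
  then show ?thesis
    unfolding Basis using inj by (simp add: prod.reindex F inner_axis o_def)
qed

lemma sets_gauss [simp, measurable_cong]: "sets (gauss \<theta>) = sets borel"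
  by (simp add: gauss_def)

lemma space_gauss [simp]: "space (gauss \<theta>) = UNIV"
  by (simp add: gauss_def)

lemma measurable_vec_nth [measurable]: "(\<lambda>x::real^'n. x $ i) \<in> borel_measurable borel"
  by (intro borel_measurable_continuous_onI continuous_intros)

lemma nn_integral_gauss_prod:
  fixes f :: "'n::finite \<Rightarrow> real \<Rightarrow> ennreal"
  assumes [measurable]: "\<And>i. f i \<in> borel_measurable borel"
  shows "(\<integral>\<^sup>+x. (\<Prod>i\<in>UNIV. f i (x $ i)) \<partial>gauss \<theta>)
       = (\<Prod>i\<in>UNIV. \<integral>\<^sup>+t. ennreal (normal_density (fst \<theta> $ i) (snd \<theta>) t) * f i t \<partial>lborel)"
proof -
  have "(\<integral>\<^sup>+x. (\<Prod>i\<in>UNIV. f i (x $ i)) \<partial>gauss \<theta>)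
     = (\<integral>\<^sup>+x. (\<Prod>i\<in>UNIV. ennreal (normal_density (fst \<theta> $ i) (snd \<theta>) (x $ i)) * f i (x $ i)) \<partial>lborel)"
    unfolding gauss_def by (subst nn_integral_density) (auto simp: prod.distrib prod_ennreal)
  also have "\<dots> = (\<Prod>i\<in>UNIV. \<integral>\<^sup>+t. ennreal (normal_density (fst \<theta> $ i) (snd \<theta>) t) * f i t \<partial>lborel)"
    by (rule nn_integral_lborel_vec_prod) measurable
  finally show ?thesis .
qed

lemma nn_integral_normal_density:
  assumes "\<sigma> > 0" shows "(\<integral>\<^sup>+t. ennreal (normal_density m \<sigma> t) \<partial>lborel) = 1"
  using assms by (subst nn_integral_eq_integral) auto

lemma prob_space_gauss: "snd \<theta> > 0 \<Longrightarrow> prob_space (gauss \<theta>)"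
  using nn_integral_gauss_prod[of "\<lambda>_ _. 1" \<theta>]
  by (intro prob_spaceI) (simp add: nn_integral_normal_density)

text \<open>
Also valid for negative \<open>\<sigma>\<close>, since the density depends on \<open>\<sigma>\<close> through \<open>\<sigma>\<^sup>2\<close> only. The kernels must be
measurable on the whole parameter type, so these values of \<open>\<sigma>\<close> have to be covered.
\<close>

lemma gauss_affine:
  fixes m :: "real ^ 'n"
  assumes "\<sigma> \<noteq> 0"
  shows "gauss (m, \<sigma>) = distr (gauss (0, 1)) borel (\<lambda>z. m + \<sigma> *\<^sub>R z)"
proof -
  let ?T = "\<lambda>z::real^'n. m + \<sigma> *\<^sub>R z" and ?g = "\<lambda>x. \<Prod>i\<in>UNIV. normal_density (m $ i) \<sigma> (x $ i)"
  have dens: "\<bar>\<sigma>\<bar> ^ CARD('n) * ?g (?T x) = (\<Prod>i\<in>UNIV. normal_density 0 1 (x $ i))" for x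
  proof -
    have "\<bar>\<sigma>\<bar> * normal_density (m $ i) \<sigma> (m $ i + \<sigma> * t) = normal_density 0 1 t" for i t
      using assms by (simp add: normal_density_def real_sqrt_mult power_mult_distrib)
    then show ?thesis by (simp add: prod.distrib[symmetric] flip: prod_constant)
  qed
  have "gauss (m, \<sigma>) = density (density (distr lborel borel ?T) (\<lambda>_. ennreal (\<bar>\<sigma>\<bar> ^ CARD('n)))) (\<lambda>x. ennreal (?g x))"
    using lborel_affine[OF assms, of m] by (simp add: gauss_def)
  also have "\<dots> = density (distr lborel borel ?T) (\<lambda>x. ennreal (\<bar>\<sigma>\<bar> ^ CARD('n) * ?g x))"
    by (subst density_density_eq) (auto simp: ennreal_mult'' prod_nonneg)
  also have "\<dots> = distr (gauss (0, 1)) borel ?T"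
    by (subst density_distr) (simp_all only: dens gauss_def fst_conv snd_conv zero_index, measurable)
  finally show ?thesis .
qed

lemma nn_integral_std_normal_shift_square:
  "(\<integral>\<^sup>+t. ennreal (std_normal_density t) * ennreal ((c + t)\<^sup>2) \<partial>lborel) = ennreal (c\<^sup>2 + 1)"
proof -
  have 0: "has_bochner_integral lborel (\<lambda>x. std_normal_density x * x ^ 0) 1"
    using std_normal_moment_even[of 0] by simp
  have 1: "has_bochner_integral lborel (\<lambda>x. std_normal_density x * x ^ 1) 0"
    using std_normal_moment_odd[of 0] by simp
  have 2: "has_bochner_integral lborel (\<lambda>x. std_normal_density x * x ^ 2) 1"
    using std_normal_moment_even[of 1] by simp
  have "has_bochner_integral lborel
      (\<lambda>x. c\<^sup>2 * (std_normal_density x * x ^ 0) + 2 * c * (std_normal_density x * x ^ 1) + std_normal_density x * x ^ 2)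
      (c\<^sup>2 * 1 + 2 * c * 0 + 1)"
    by (intro has_bochner_integral_add has_bochner_integral_mult_right 0 1 2)
  then have *: "has_bochner_integral lborel (\<lambda>x. std_normal_density x * (c + x)\<^sup>2) (c\<^sup>2 + 1)"
    by (simp add: power2_sum algebra_simps)
  show ?thesis
    by (subst ennreal_mult''[symmetric], simp)
       (subst nn_integral_eq_integral, use * in \<open>auto simp: has_bochner_integral_iff\<close>)
qed

lemma nn_integral_std_gauss_norm_square:
  fixes c :: "real ^ 'n"
  shows "(\<integral>\<^sup>+z. ennreal ((norm (c + z))\<^sup>2) \<partial>gauss (0, 1)) = ennreal ((norm c)\<^sup>2 + real CARD('n))"
proof -
  have nrm: "(norm x)\<^sup>2 = (\<Sum>j\<in>UNIV. (x $ j)\<^sup>2)" for x :: "real ^ 'n"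
    by (simp add: norm_vec_def L2_set_def sum_nonneg)
  have coord: "(\<integral>\<^sup>+z. ennreal ((c $ j + z $ j)\<^sup>2) \<partial>gauss (0, 1)) = ennreal ((c $ j)\<^sup>2 + 1)" for j
  proof -
    let ?f = "\<lambda>i t. if i = j then ennreal ((c $ j + t)\<^sup>2) else 1"
    have "(\<integral>\<^sup>+z. ennreal ((c $ j + z $ j)\<^sup>2) \<partial>gauss (0, 1)) = (\<integral>\<^sup>+z. (\<Prod>i\<in>UNIV. ?f i (z $ i)) \<partial>gauss (0, 1))"
      by (simp add: prod.delta)
    also have "\<dots> = (\<Prod>i\<in>UNIV. \<integral>\<^sup>+t. ennreal (std_normal_density t) * ?f i t \<partial>lborel)"
      by (subst nn_integral_gauss_prod) auto
    also have "\<dots> = (\<Prod>i\<in>UNIV. if i = j then ennreal ((c $ j)\<^sup>2 + 1) else 1)"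
      by (intro prod.cong) (auto simp: nn_integral_std_normal_shift_square nn_integral_normal_density)
    finally show ?thesis by (simp add: prod.delta)
  qed
  have "(\<integral>\<^sup>+z. ennreal ((norm (c + z))\<^sup>2) \<partial>gauss (0, 1)) = (\<Sum>j\<in>UNIV. \<integral>\<^sup>+z. ennreal ((c $ j + z $ j)\<^sup>2) \<partial>gauss (0, 1))"
    by (simp add: nrm nn_integral_sum flip: sum_ennreal)
  also have "\<dots> = ennreal ((norm c)\<^sup>2 + real CARD('n))"
    by (simp add: coord nrm sum.distrib sum_nonneg sum_ennreal ennreal_of_nat_eq_real_of_nat flip: ennreal_plus)
  finally show ?thesis .
qed

text \<open>
Bounds a power of \<open>1 + \<parallel>z\<parallel>\<^sup>2\<close> by a product over the coordinates, and a power of \<open>T\<close> by a product over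
the samples, so that all moments reduce to one-dimensional ones.
\<close>

lemma one_plus_sum_le_prod:
  fixes q :: "'i \<Rightarrow> real"
  assumes "\<And>i. i \<in> S \<Longrightarrow> q i \<ge> 0"
  shows "1 + (\<Sum>i\<in>S. q i) \<le> (\<Prod>i\<in>S. 1 + q i)"
  using assms
proof (induction S rule: infinite_finite_induct)
  case (insert i S)
  have "1 + (\<Sum>i\<in>insert i S. q i) \<le> (1 + q i) * (1 + (\<Sum>i\<in>S. q i))"
    using insert by (simp add: algebra_simps sum_nonneg)
  also have "\<dots> \<le> (1 + q i) * (\<Prod>i\<in>S. 1 + q i)"
    using insert by (intro mult_left_mono) auto
  finally show ?case using insert by simp
qed auto

lemma nn_integral_std_gauss_moment:
  "(\<integral>\<^sup>+z. ennreal ((1 + (norm z)\<^sup>2) ^ k) \<partial>gauss (0 :: real ^ 'n, 1)) < \<infinity>"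
proof -
  have nrm: "1 + (norm x)\<^sup>2 \<le> (\<Prod>j\<in>UNIV. 1 + (x $ j)\<^sup>2)" for x :: "real ^ 'n"
    by (simp add: norm_vec_def L2_set_def sum_nonneg one_plus_sum_le_prod)
  have int: "integrable lborel (\<lambda>t. std_normal_density t * (1 + t\<^sup>2) ^ k)"
  proof -
    have "(\<lambda>t::real. std_normal_density t * (1 + t\<^sup>2) ^ k)
        = (\<lambda>t. \<Sum>j\<le>k. of_nat (k choose j) * (std_normal_density t * t ^ (2 * j)))"
      by (subst add.commute, subst binomial_ring)
        (simp add: sum_distrib_left power_mult[of _ 2] mult.left_commute)
    then show ?thesis
      by (auto intro!: Bochner_Integration.integrable_sum integrable_mult_right integrable_std_normal_moment)
  qed
  have "(\<integral>\<^sup>+z. ennreal ((1 + (norm z)\<^sup>2) ^ k) \<partial>gauss (0 :: real ^ 'n, 1))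
      \<le> (\<integral>\<^sup>+z. (\<Prod>j\<in>UNIV. ennreal ((1 + (z $ j)\<^sup>2) ^ k)) \<partial>gauss (0 :: real ^ 'n, 1))"
    by (intro nn_integral_mono)
      (subst prod_ennreal, simp, subst prod_power_distrib[symmetric],
        intro ennreal_leI power_mono nrm, simp)
  also have "\<dots> = (\<Prod>i\<in>(UNIV::'n set). \<integral>\<^sup>+t. ennreal (std_normal_density t) * ennreal ((1 + t\<^sup>2) ^ k) \<partial>lborel)"
    by (subst nn_integral_gauss_prod) auto
  also have "\<dots> < \<infinity>"
  proof -
    have "(\<integral>\<^sup>+t. ennreal (std_normal_density t) * ennreal ((1 + t\<^sup>2) ^ k) \<partial>lborel) = ennreal (\<integral>t. std_normal_density t * (1 + t\<^sup>2) ^ k \<partial>lborel)"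
      by (subst nn_integral_eq_integral[OF int, symmetric]) (auto simp: ennreal_mult'')
    then show ?thesis by (simp add: ennreal_power)
  qed
  finally show ?thesis .
qed

section \<open>The sampling distribution and the transition kernel\<close>

text \<open>
The numbers of better and of tied samples are measurable, hence so is the weight as a function of
these two numbers.
\<close>

lemma measurable_card_filter:
  assumes "finite S" and [measurable]: "\<And>j. j \<in> S \<Longrightarrow> Measurable.pred M (P j)"
  shows "(\<lambda>\<omega>. card {j\<in>S. P j \<omega>}) \<in> measurable M (count_space UNIV)"
proof -
  have "card {j\<in>S. P j \<omega>} = (\<Sum>j\<in>S. if P j \<omega> then 1 else 0)" for \<omega>
    using assms(1) by (simp add: sum.If_cases Collect_conj_eq)
  moreover have "(\<lambda>\<omega>. \<Sum>j\<in>S. if P j \<omega> then 1 else (0::nat)) \<in> measurable M (count_space UNIV)"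
    using assms by (induction S rule: finite_induct) (simp_all, measurable)
  ultimately show ?thesis by simp
qed

lemma measurable_tie_weight:
  assumes S: "finite S" "i \<in> S"
    and [measurable]: "\<And>j. j \<in> S \<Longrightarrow> Y j \<in> borel_measurable M"
  shows "(\<lambda>\<omega>. tie_weight S w (\<lambda>j. Y j \<omega>) i) \<in> borel_measurable M"
proof -
  have [measurable]: "Y i \<in> borel_measurable M" using S by simp
  have [measurable]: "(\<lambda>\<omega>. card {j\<in>S. j \<noteq> i \<and> Y j \<omega> < Y i \<omega>}) \<in> measurable M (count_space UNIV)"
    "(\<lambda>\<omega>. card {j\<in>S. j \<noteq> i \<and> Y j \<omega> = Y i \<omega>}) \<in> measurable M (count_space UNIV)"
    using S(1) by (rule measurable_card_filter; measurable)+
  show ?thesis unfolding tie_weight_def Let_def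
    by (rule measurable_compose_countable[where f="\<lambda>k \<omega>. \<Sum>j = k..k + card {j\<in>S. j \<noteq> i \<and> Y j \<omega> = Y i \<omega>}.
          w (j + 1) / real (card {j\<in>S. j \<noteq> i \<and> Y j \<omega> = Y i \<omega>} + 1)"])
       (rule measurable_compose_countable[where f="\<lambda>l \<omega>. \<Sum>j = _.._ + l. w (j + 1) / real (l + 1)"], simp_all)
qed

lemma sets_samples [measurable_cong]: "sets (samples lam \<theta>) = sets (\<Pi>\<^sub>M i\<in>{1..lam}. borel)"
  unfolding samples_def by (intro sets_PiM_cong) auto

lemma prob_space_samples: "snd \<theta> > 0 \<Longrightarrow> prob_space (samples lam \<theta>)"
  unfolding samples_def by (intro prob_space_PiM prob_space_gauss)

lemma samples_affine:
  fixes m :: "real ^ 'n"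
  assumes "\<sigma> \<noteq> 0"
  shows "samples lam (m, \<sigma>) = distr (samples lam (0, 1)) (\<Pi>\<^sub>M i\<in>{1..lam}. borel) (compose {1..lam} (\<lambda>z. m + \<sigma> *\<^sub>R z))"
proof -
  have "samples lam (m, \<sigma>) = (\<Pi>\<^sub>M i\<in>{1..lam}. distr (gauss (0, 1)) (gauss (0, 1)) (\<lambda>z. m + \<sigma> *\<^sub>R z))"
    unfolding samples_def gauss_affine[OF assms, of m]
    by (intro PiM_cong distr_cong refl) auto
  also have "\<dots> = distr (samples lam (0, 1)) (samples lam (0, 1)) (compose {1..lam} (\<lambda>z. m + \<sigma> *\<^sub>R z))"
    unfolding samples_def
    by (rule distr_PiM_finite_prob_space'[symmetric]) (auto intro: prob_space_gauss)
  also have "\<dots> = distr (samples lam (0, 1)) (\<Pi>\<^sub>M i\<in>{1..lam}. borel) (compose {1..lam} (\<lambda>z. m + \<sigma> *\<^sub>R z))"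
    by (intro distr_cong refl) (auto simp: sets_samples)
  finally show ?thesis .
qed

lemma measurable_affine_compose:
  "compose {1..lam} (\<lambda>z. m + \<sigma> *\<^sub>R z :: real ^ 'n) \<in> measurable (samples lam (0, 1)) (\<Pi>\<^sub>M i\<in>{1..lam}. borel)"
  unfolding compose_def by (rule measurable_restrict) measurable

lemma increment_cong:
  "(\<And>i. i \<in> {1..lam} \<Longrightarrow> x i = y i) \<Longrightarrow> increment f w lam \<theta> x = increment f w lam \<theta> y"
  unfolding increment_def rank_weight_eq_tie_weight
  by (intro sum.cong refl arg_cong2[where f="(*\<^sub>R)"] tie_weight_cong) auto

lemma borel_measurable_fst_snd [measurable]:
  "fst \<in> borel_measurable (borel :: ((real ^ 'n) \<times> real) measure)"
  "snd \<in> borel_measurable (borel :: ((real ^ 'n) \<times> real) measure)"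
  by (auto intro!: borel_measurable_continuous_onI simp: continuous_on_fst continuous_on_snd)

lemma measurable_increment:
  fixes x :: "'a \<Rightarrow> nat \<Rightarrow> real ^ 'n"
  assumes [measurable]: "f \<in> borel_measurable borel" "\<theta> \<in> borel_measurable M"
    and [measurable]: "\<And>i. i \<in> {1..lam} \<Longrightarrow> (\<lambda>\<omega>. x \<omega> i) \<in> borel_measurable M"
  shows "(\<lambda>\<omega>. increment f w lam (\<theta> \<omega>) (x \<omega>)) \<in> borel_measurable M"
proof -
  have [measurable]: "(\<lambda>\<omega>. fst (\<theta> \<omega>)) \<in> borel_measurable M" "(\<lambda>\<omega>. snd (\<theta> \<omega>)) \<in> borel_measurable M"
    using measurable_compose[OF assms(2) borel_measurable_fst_snd(1)]
      measurable_compose[OF assms(2) borel_measurable_fst_snd(2)] by simp_all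
  have [measurable]: "(\<lambda>\<omega>. tie_weight {1..lam} w (\<lambda>j. f (x \<omega> j)) i) \<in> borel_measurable M"
    if "i \<in> {1..lam}" for i
    using that by (intro measurable_tie_weight) auto
  show ?thesis
    unfolding increment_def rank_weight_eq_tie_weight search_dir_def Let_def
    by (intro borel_measurable_sum borel_measurable_scaleR borel_measurable_Pair) measurable
qed

text \<open>
The kernel as a pushforward of one fixed measure. The parameter then occurs only in the map, which
gives measurability in the parameter and lets all parameters share the same moment bounds.
\<close>

lemma ssa_kernel_eq:
  fixes m :: "real ^ 'n"
  assumes [measurable]: "f \<in> borel_measurable borel" and "\<sigma> \<noteq> 0"
  shows "ssa_kernel f w lam \<alpha> (m, \<sigma>) = distr (samples lam (0, 1)) borel
    (\<lambda>z. (m, \<sigma>) + \<alpha> *\<^sub>R increment f w lam (m, \<sigma>) (\<lambda>i. m + \<sigma> *\<^sub>R z i))"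
proof -
  have [measurable]: "(\<lambda>x. increment f w lam (m, \<sigma>) x) \<in> measurable (\<Pi>\<^sub>M i\<in>{1..lam}. borel) borel"
    by (rule measurable_increment) auto
  have *: "(\<lambda>x. (m, \<sigma>) + \<alpha> *\<^sub>R increment f w lam (m, \<sigma>) x) \<in> measurable (\<Pi>\<^sub>M i\<in>{1..lam}. borel) borel"
    by measurable
  have "increment f w lam (m, \<sigma>) (compose {1..lam} (\<lambda>z. m + \<sigma> *\<^sub>R z) z)
      = increment f w lam (m, \<sigma>) (\<lambda>i. m + \<sigma> *\<^sub>R z i)" for z
    by (rule increment_cong) (simp add: compose_def)
  then show ?thesis unfolding ssa_kernel_def samples_affine[OF assms(2)]
    by (subst distr_distr[OF * measurable_affine_compose]) (simp add: o_def)
qed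

lemma gauss_zero: "gauss (m, 0) = null_measure borel"
proof -
  have *: "(\<Prod>i\<in>UNIV. normal_density (m $ i) 0 (x $ i)) = 0" for x by (simp add: normal_density_def)
  show ?thesis unfolding gauss_def fst_conv snd_conv *
    by (intro measure_eqI) (auto simp: emeasure_density)
qed

text \<open>
At \<open>\<sigma> = 0\<close> every factor of the product measure is null, and there is at least one factor.
\<close>

lemma ssa_kernel_zero:
  assumes "lam \<ge> 1"
  shows "ssa_kernel f w lam \<alpha> (m :: real ^ 'n, 0) = null_measure borel"
proof (rule measure_eqI)
  fix A assume "A \<in> sets (ssa_kernel f w lam \<alpha> (m, 0))"
  interpret finite_measure "gauss (m, 0)" by (intro finite_measureI) (simp add: gauss_zero)
  interpret product_sigma_finite "\<lambda>_::nat. gauss (m, 0)" by unfold_locales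
  have "emeasure (samples lam (m, 0)) (space (samples lam (m, 0))) = 0"
    unfolding samples_def space_PiM using assms by (subst emeasure_PiM) (auto simp: gauss_zero)
  then have "emeasure (samples lam (m, 0)) B = 0" for B
    using emeasure_mono[of B "space (samples lam (m, 0))"]
    by (metis emeasure_notin_sets le_zero_eq sets.sets_into_space sets.top emeasure_space)
  then have "emeasure (ssa_kernel f w lam \<alpha> (m, 0)) A = 0"
    by (cases "(\<lambda>x. (m, 0) + \<alpha> *\<^sub>R increment f w lam (m, 0) x) \<in> measurable (samples lam (m, 0)) borel")
       (auto simp: ssa_kernel_def distr_def emeasure_measure_of_conv)
  then show "emeasure (ssa_kernel f w lam \<alpha> (m, 0)) A = emeasure (null_measure borel) A" by simp
qed (simp add: ssa_kernel_def)

lemma measurable_ssa_kernel: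
  assumes [measurable]: "f \<in> borel_measurable borel" and lam: "lam \<ge> 1"
  shows "ssa_kernel f w lam \<alpha> \<in> measurable borel (subprob_algebra (borel :: ((real ^ 'n) \<times> real) measure))"
proof -
  let ?Z = "samples lam (0 :: real ^ 'n, 1)"
  let ?h = "\<lambda>\<theta> z. \<theta> + \<alpha> *\<^sub>R increment f w lam \<theta> (\<lambda>i. fst \<theta> + snd \<theta> *\<^sub>R z i)"
  have eq: "ssa_kernel f w lam \<alpha> \<theta> = (if snd \<theta> = 0 then null_measure borel else distr ?Z borel (?h \<theta>))" for \<theta>
    using ssa_kernel_eq[OF assms(1), of "snd \<theta>" w lam \<alpha> "fst \<theta>"] ssa_kernel_zero[OF lam, of f w \<alpha> "fst \<theta>"]
    by (cases \<theta>) auto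
  have [measurable]: "(\<lambda>p. snd p i) \<in> borel_measurable (borel \<Otimes>\<^sub>M ?Z)" if "i \<in> {1..lam}" for i
    using that by (intro measurable_compose[OF measurable_snd]) measurable
  have [measurable]: "(\<lambda>p. fst (fst p)) \<in> borel_measurable ((borel :: ((real ^ 'n) \<times> real) measure) \<Otimes>\<^sub>M ?Z)"
    "(\<lambda>p. snd (fst p)) \<in> borel_measurable ((borel :: ((real ^ 'n) \<times> real) measure) \<Otimes>\<^sub>M ?Z)"
    using measurable_compose[OF measurable_fst borel_measurable_fst_snd(1)]
      measurable_compose[OF measurable_fst borel_measurable_fst_snd(2)] by auto
  have "(\<lambda>p. increment f w lam (fst p) (\<lambda>i. fst (fst p) + snd (fst p) *\<^sub>R snd p i)) \<in> borel_measurable (borel \<Otimes>\<^sub>M ?Z)"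
    by (rule measurable_increment) measurable
  then have h: "case_prod ?h \<in> borel_measurable (borel \<Otimes>\<^sub>M ?Z)"
    by (simp add: split_beta')
  have "?Z \<in> space (subprob_algebra ?Z)"
    using prob_space_imp_subprob_space[OF prob_space_samples[of "(0, 1)" lam]]
    by (auto simp: space_subprob_algebra)
  then have D: "(\<lambda>\<theta>. distr ?Z borel (?h \<theta>)) \<in> measurable borel (subprob_algebra borel)"
    by (intro measurable_distr2[OF h]) simp
  have N: "(\<lambda>\<theta>. null_measure borel) \<in> measurable (borel :: ((real ^ 'n) \<times> real) measure) (subprob_algebra (borel :: ((real ^ 'n) \<times> real) measure))"
    by (auto simp: space_subprob_algebra subprob_space_null_measure)
  have "{\<theta> \<in> space borel. snd \<theta> = 0} \<in> sets (borel :: ((real ^ 'n) \<times> real) measure)"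
    by measurable
  then show ?thesis unfolding eq[abs_def] by (rule measurable_If[OF N D])
qed

lemma measurable_gauss_kernel:
  "gauss \<in> measurable borel (subprob_algebra (borel :: (real ^ 'n) measure))"
proof -
  let ?G = "gauss (0 :: real ^ 'n, 1)"
  have eq: "gauss \<theta> = (if snd \<theta> = 0 then null_measure borel else distr ?G borel (\<lambda>z. fst \<theta> + snd \<theta> *\<^sub>R z))"
    for \<theta> :: "(real ^ 'n) \<times> real"
    using gauss_affine[of "snd \<theta>" "fst \<theta>"] gauss_zero[of "fst \<theta>"] by (cases \<theta>) auto
  have [measurable]: "(\<lambda>p. fst (fst p)) \<in> borel_measurable ((borel :: ((real ^ 'n) \<times> real) measure) \<Otimes>\<^sub>M ?G)"
    "(\<lambda>p. snd (fst p)) \<in> borel_measurable ((borel :: ((real ^ 'n) \<times> real) measure) \<Otimes>\<^sub>M ?G)"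
    using measurable_compose[OF measurable_fst borel_measurable_fst_snd(1)]
      measurable_compose[OF measurable_fst borel_measurable_fst_snd(2)] by auto
  have h: "case_prod (\<lambda>\<theta> z. fst \<theta> + snd \<theta> *\<^sub>R z) \<in> borel_measurable ((borel :: ((real ^ 'n) \<times> real) measure) \<Otimes>\<^sub>M ?G)"
    unfolding split_beta' by measurable
  have "?G \<in> space (subprob_algebra ?G)"
    using prob_space_imp_subprob_space[OF prob_space_gauss[of "(0, 1)"]]
    by (auto simp: space_subprob_algebra)
  then have D: "(\<lambda>\<theta>. distr ?G borel (\<lambda>z. fst \<theta> + snd \<theta> *\<^sub>R z)) \<in> measurable borel (subprob_algebra borel)"
    by (intro measurable_distr2[OF h]) simp
  have N: "(\<lambda>\<theta>. null_measure borel) \<in> measurable (borel :: ((real ^ 'n) \<times> real) measure) (subprob_algebra (borel :: (real ^ 'n) measure))"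
    by (auto simp: space_subprob_algebra subprob_space_null_measure)
  have "{\<theta> \<in> space borel. snd \<theta> = 0} \<in> sets (borel :: ((real ^ 'n) \<times> real) measure)"
    by measurable
  from measurable_If[OF N D this] show ?thesis by (simp only: eq[symmetric])
qed

lemma integrable_samples_moment:
  "integrable (samples lam (0 :: real ^ 'n, 1)) (\<lambda>z. (1 + (\<Sum>i = 1..lam. (norm (z i))\<^sup>2)) ^ k)"
proof -
  interpret prob_space "gauss (0 :: real ^ 'n, 1)" by (rule prob_space_gauss) simp
  interpret product_sigma_finite "\<lambda>_::nat. gauss (0 :: real ^ 'n, 1)" by unfold_locales
  have prod: "integrable (samples lam (0 :: real ^ 'n, 1)) (\<lambda>z. \<Prod>i = 1..lam. (1 + (norm (z i))\<^sup>2) ^ k)"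
    unfolding samples_def using nn_integral_std_gauss_moment[where 'n='n and k=k]
    by (intro product_integrable_prod) (auto simp: integrable_iff_bounded)
  show ?thesis
  proof (rule Bochner_Integration.integrable_bound[OF prod])
    show "(\<lambda>z. (1 + (\<Sum>i = 1..lam. (norm (z i))\<^sup>2)) ^ k) \<in> borel_measurable (samples lam (0 :: real ^ 'n, 1))"
      by measurable
    have "(1 + (\<Sum>i = 1..lam. (norm (z i))\<^sup>2)) ^ k \<le> (\<Prod>i = 1..lam. (1 + (norm (z i))\<^sup>2) ^ k)" for z :: "nat \<Rightarrow> real ^ 'n"
      unfolding prod_power_distrib[symmetric]
      by (intro power_mono one_plus_sum_le_prod add_nonneg_nonneg sum_nonneg) auto
    then show "AE z in samples lam (0 :: real ^ 'n, 1). norm ((1 + (\<Sum>i = 1..lam. (norm (z i))\<^sup>2)) ^ k)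
        \<le> norm (\<Prod>i = 1..lam. (1 + (norm (z i))\<^sup>2) ^ k)"
      by (auto simp: abs_mult sum_nonneg prod_nonneg)
  qed
qed

lemma has_bochner_integral_samples_norm_square:
  fixes c :: "real ^ 'n"
  assumes "i \<in> {1..lam}"
  shows "has_bochner_integral (samples lam (0, 1)) (\<lambda>z. (norm (c + z i))\<^sup>2) ((norm c)\<^sup>2 + real CARD('n))"
proof (rule has_bochner_integral_nn_integral)
  show "(\<lambda>z. (norm (c + z i))\<^sup>2) \<in> borel_measurable (samples lam (0, 1))"
    using assms by measurable
  have "(\<integral>\<^sup>+z. ennreal ((norm (c + z))\<^sup>2) \<partial>gauss (0, 1))
      = (\<integral>\<^sup>+z. ennreal ((norm (c + z))\<^sup>2) \<partial>distr (samples lam (0, 1)) (gauss (0, 1)) (\<lambda>z. z i))"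
    unfolding samples_def using assms
    by (subst distr_PiM_component) (auto intro: prob_space_gauss)
  also have "\<dots> = (\<integral>\<^sup>+z. ennreal ((norm (c + z i))\<^sup>2) \<partial>samples lam (0, 1))"
    using assms by (subst nn_integral_distr) (auto, measurable)
  finally show "(\<integral>\<^sup>+z. ennreal ((norm (c + z i))\<^sup>2) \<partial>samples lam (0, 1)) = ennreal ((norm c)\<^sup>2 + real CARD('n))"
    by (simp add: nn_integral_std_gauss_norm_square)
qed auto

lemma emeasure_gauss_eq_0_iff:
  fixes \<theta> :: "(real ^ 'n) \<times> real"
  assumes "snd \<theta> > 0" "A \<in> sets borel"
  shows "emeasure (gauss \<theta>) A = 0 \<longleftrightarrow> emeasure lborel A = 0"
proof -
  have "(\<Prod>i\<in>UNIV. normal_density (fst \<theta> $ i) (snd \<theta>) (x $ i)) > 0" for x :: "real ^ 'n"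
    using assms by (intro prod_pos) (simp add: normal_density_pos)
  then have "A \<in> null_sets (gauss \<theta>) \<longleftrightarrow> A \<in> null_sets lborel"
    using assms(2) unfolding gauss_def
    by (subst null_sets_density_iff) (simp_all add: AE_iff_null_sets order.strict_implies_not_eq[symmetric] leD not_le)
  then show ?thesis using assms by (simp add: null_sets_def)
qed

lemma emeasure_gauss_open_pos:
  fixes \<theta> :: "(real ^ 'n) \<times> real"
  assumes "snd \<theta> > 0" "open A" "A \<noteq> {}"
  shows "emeasure (gauss \<theta>) A > 0"
proof -
  have "A \<notin> null_sets lborel"
    using open_not_negligible[OF assms(2,3)] assms(2)
    by (auto simp: negligible_iff_null_sets null_sets_completion_iff)
  then show ?thesis using emeasure_gauss_eq_0_iff[OF assms(1), of A] assms(2)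
    by (auto simp: null_sets_def zero_less_iff_neq_zero)
qed

text \<open>
The event that the first sample lies near the origin and all others far away. It is described in terms
of the standard Gaussian samples, so its probability is the same for every parameter.
\<close>

lemma samples_separated_event_pos:
  fixes R :: real
  defines "A \<equiv> (\<lambda>i::nat. if i = 1 then ball 0 1 else - cball (0 :: real ^ 'n) R)"
  shows "measure (samples lam (0, 1)) (Pi\<^sub>E {1..lam} A) > 0" "Pi\<^sub>E {1..lam} A \<in> sets (samples lam (0, 1))"
proof -
  interpret prob_space "gauss (0 :: real ^ 'n, 1)" by (rule prob_space_gauss) simp
  interpret product_sigma_finite "\<lambda>_::nat. gauss (0 :: real ^ 'n, 1)" by unfold_locales
  interpret S: prob_space "samples lam (0 :: real ^ 'n, 1)" by (rule prob_space_samples) simp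
  have A: "open (A i)" for i by (auto simp: A_def)
  have ne: "A i \<noteq> {}" for i
  proof -
    obtain x :: "real ^ 'n" where "norm x = \<bar>R\<bar> + 1" using vector_choose_size[of "\<bar>R\<bar> + 1"] by auto
    then have "x \<in> - cball 0 R" by auto
    moreover have "0 \<in> ball (0 :: real ^ 'n) 1" by simp
    ultimately show ?thesis unfolding A_def by (cases "i = 1") force+
  qed
  have m: "A i \<in> sets borel" for i using A[of i] by (rule borel_open)
  show sets: "Pi\<^sub>E {1..lam} A \<in> sets (samples lam (0, 1))"
    unfolding samples_def using m by (intro sets_PiM_I_finite) auto
  have "emeasure (samples lam (0, 1)) (Pi\<^sub>E {1..lam} A) = (\<Prod>i\<in>{1..lam}. emeasure (gauss (0, 1)) (A i))"
    unfolding samples_def using m by (subst emeasure_PiM) auto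
  also have "\<dots> > 0"
    using emeasure_gauss_open_pos[OF _ A ne, of "(0, 1)"]
    by (auto simp: zero_less_iff_neq_zero prod_zero_iff)
  finally show "measure (samples lam (0, 1)) (Pi\<^sub>E {1..lam} A) > 0"
    by (simp add: S.emeasure_eq_measure)
qed

section \<open>Second-order expansion of one step\<close>

text \<open>
Second-order Taylor bound. It follows from
\<open>1 - (1 - 2 \<alpha> b) (1 + \<alpha> b)\<^sup>2 = \<alpha>\<^sup>2 (3 b\<^sup>2 + 2 \<alpha> b\<^sup>3)\<close> and \<open>1 + \<alpha> b \<ge> 3/4\<close>.
\<close>

lemma inverse_square_upper_bound:
  fixes \<alpha> b T :: real
  assumes \<alpha>: "0 < \<alpha>" "\<alpha> \<le> 1/2" and T: "T \<ge> 1" and b: "\<bar>b\<bar> \<le> T" "b \<ge> -1/2"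
  shows "1 / (1 + \<alpha> * b)\<^sup>2 \<le> 1 - 2 * \<alpha> * b + 10 * \<alpha>\<^sup>2 * T ^ 3"
proof -
  have ab: "1 + \<alpha> * b \<ge> 3/4"
  proof -
    have "\<alpha> * b \<ge> \<alpha> * (-1/2)" using \<alpha> b by (intro mult_left_mono) auto
    then show ?thesis using \<alpha> by simp
  qed
  have b2: "b\<^sup>2 \<le> T\<^sup>2" using b T by (intro abs_le_square_iff[THEN iffD1]) auto
  have "T\<^sup>2 \<le> T ^ 3" using T by (intro power_increasing) auto
  with b2 have b2': "b\<^sup>2 \<le> T ^ 3" by simp
  have "\<bar>b\<bar> ^ 3 \<le> T ^ 3" using b by (intro power_mono) auto
  then have "b ^ 3 \<le> T ^ 3" using abs_ge_self[of "b ^ 3"] unfolding power_abs by linarith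
  then have "2 * \<alpha> * b ^ 3 \<le> 2 * \<alpha> * T ^ 3" using \<alpha> by (intro mult_left_mono) auto
  also have "\<dots> \<le> 1 * T ^ 3" using \<alpha> T by (intro mult_right_mono) auto
  finally have "3 * b\<^sup>2 + 2 * \<alpha> * b ^ 3 \<le> 4 * T ^ 3" using b2' by simp
  then have "\<alpha>\<^sup>2 * (3 * b\<^sup>2 + 2 * \<alpha> * b ^ 3) \<le> \<alpha>\<^sup>2 * (4 * T ^ 3)"
    by (intro mult_left_mono) auto
  also have "\<dots> \<le> 10 * \<alpha>\<^sup>2 * T ^ 3 * (3/4)\<^sup>2"
  proof -
    have "0 \<le> \<alpha>\<^sup>2 * T ^ 3" using T by simp
    then show ?thesis by (simp add: power2_eq_square)
  qed
  also have "\<dots> \<le> 10 * \<alpha>\<^sup>2 * T ^ 3 * (1 + \<alpha> * b)\<^sup>2"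
    using ab T by (intro mult_left_mono power_mono) auto
  finally have "\<alpha>\<^sup>2 * (3 * b\<^sup>2 + 2 * \<alpha> * b ^ 3) \<le> 10 * \<alpha>\<^sup>2 * T ^ 3 * (1 + \<alpha> * b)\<^sup>2" .
  moreover have "1 - (1 - 2 * \<alpha> * b) * (1 + \<alpha> * b)\<^sup>2 = \<alpha>\<^sup>2 * (3 * b\<^sup>2 + 2 * \<alpha> * b ^ 3)"
    by (simp add: algebra_simps power2_eq_square power3_eq_cube)
  ultimately have "1 \<le> (1 - 2 * \<alpha> * b + 10 * \<alpha>\<^sup>2 * T ^ 3) * (1 + \<alpha> * b)\<^sup>2"
    by (simp add: distrib_right)
  then show ?thesis using ab by (simp add: divide_le_eq)
qed

text \<open>
The expansion of \<open>L\<close> along one step in scalar form: \<open>s = \<parallel>\<mu>\<parallel>\<^sup>2\<close>, \<open>p = \<mu> \<bullet> a\<close>, \<open>A = \<parallel>a\<parallel>\<^sup>2\<close>, and \<open>N\<close> is the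
squared norm of the new mean \<open>\<mu> + \<alpha> a\<close>. The function \<open>V\<close> is quadratic in \<open>\<alpha>\<close>, and \<open>\<xi>\<^sup>2\<close> is expanded by the
preceding bound. The error has to be proportional to \<open>v (1 + \<epsilon> s)\<close>, the value of \<open>L\<close> before the step,
with a constant independent of \<open>s\<close>; this is what makes the contraction uniform in the parameter.
\<close>

lemma lyapunov_step_expansion:
  fixes s d p A b T \<alpha> \<epsilon> :: real
  assumes s: "s \<ge> 0" and d: "d \<ge> 1" and \<alpha>: "0 < \<alpha>" "\<alpha> \<le> 1/2" and \<epsilon>: "0 < \<epsilon>" "\<epsilon> \<le> 1" and T: "T \<ge> 1"
    and p: "\<bar>2 * p\<bar> \<le> (1 + s) * T" and A: "0 \<le> A" "A \<le> T\<^sup>2" and b: "\<bar>b\<bar> \<le> T" "b \<ge> -1/2"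
    and N0: "0 \<le> s + 2 * \<alpha> * p + \<alpha>\<^sup>2 * A"
  defines "v \<equiv> s + d" and "N \<equiv> s + 2 * \<alpha> * p + \<alpha>\<^sup>2 * A"
  shows "(N + d * (1 + \<alpha> * b)\<^sup>2) * (1 + \<epsilon> * (N / (1 + \<alpha> * b)\<^sup>2))
    \<le> v * (1 + \<epsilon> * s)
      + \<alpha> * ((2 * p + 2 * d * b) * (1 + \<epsilon> * s) + \<epsilon> * v * (2 * p - 2 * b * s))
      + 86 * \<alpha>\<^sup>2 * (v * (1 + \<epsilon> * s)) * T ^ 7"
proof -
  define v1 where "v1 = 2 * p + 2 * d * b"
  define v2 where "v2 = A + d * b\<^sup>2"
  define y1 where "y1 = 2 * p - 2 * b * s"
  define v' where "v' = N + d * (1 + \<alpha> * b)\<^sup>2"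
  define H where "H = 1 + \<epsilon> * s"
  have v': "v' = v + \<alpha> * v1 + \<alpha>\<^sup>2 * v2"
    by (simp add: v'_def N_def v_def v1_def v2_def power2_eq_square algebra_simps)
  have v'0: "v' \<ge> 0" using N0 d by (simp add: v'_def N_def)
  have v0: "v \<ge> 1" using s d by (simp add: v_def)
  have pw: "T ^ i \<le> T ^ j" if "i \<le> j" for i j using T that by (intro power_increasing) auto
  have pw1: "1 \<le> T ^ i" for i using T by simp
  have \<alpha>2: "\<alpha>\<^sup>2 \<le> 1/4" using power_mono[of \<alpha> "1/2" 2] \<alpha> by (simp add: power2_eq_square)
  have N_le: "N \<le> 2 * (1 + s) * T\<^sup>2"
  proof -
    have "2 * \<alpha> * p = \<alpha> * (2 * p)" by simp
    also have "\<dots> \<le> \<alpha> * ((1 + s) * T)"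
      using p \<alpha> by (intro mult_left_mono) auto
    also have "\<dots> \<le> 1/2 * ((1 + s) * T)"
      using \<alpha> s T by (intro mult_right_mono) auto
    finally have 1: "2 * \<alpha> * p \<le> 1/2 * ((1 + s) * T)" .
    have "\<alpha>\<^sup>2 * A \<le> 1/4 * T\<^sup>2" using \<alpha>2 A by (intro mult_mono) auto
    also have "\<dots> \<le> 1/4 * ((1 + s) * T\<^sup>2)" using s by (simp add: distrib_right)
    finally have 2: "\<alpha>\<^sup>2 * A \<le> 1/4 * ((1 + s) * T\<^sup>2)" .
    have 3: "(1 + s) * T \<le> (1 + s) * T\<^sup>2" using s pw[of 1 2] by (intro mult_left_mono) auto
    have "s \<le> (1 + s) * 1" by simp
    also have "\<dots> \<le> (1 + s) * T\<^sup>2" using s pw1 by (intro mult_left_mono) auto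
    finally show ?thesis using 1 2 3 s unfolding N_def mult.assoc by linarith
  qed
  have ratio: "N / (1 + \<alpha> * b)\<^sup>2 \<le> s + \<alpha> * y1 + 24 * \<alpha>\<^sup>2 * ((1 + s) * T ^ 5)"
  proof -
    have "N / (1 + \<alpha> * b)\<^sup>2 \<le> N * (1 - 2 * \<alpha> * b + 10 * \<alpha>\<^sup>2 * T ^ 3)"
      using mult_left_mono[OF inverse_square_upper_bound[OF \<alpha> T b] N0] by (simp add: N_def)
    also have "\<dots> = s + \<alpha> * y1 + \<alpha>\<^sup>2 * (A + (- b) * 2 * (2 * p) + (2 * \<alpha>) * ((- b) * A) + 10 * (T ^ 3 * N))"
      by (simp add: N_def y1_def algebra_simps power2_eq_square)
    also have "\<dots> \<le> s + \<alpha> * y1 + \<alpha>\<^sup>2 * (24 * ((1 + s) * T ^ 5))"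
    proof (intro add_left_mono mult_left_mono)
      have up: "T ^ i \<le> (1 + s) * T ^ 5" if "i \<le> 5" for i
        using mult_mono[of 1 "1 + s" "T ^ i" "T ^ 5"] pw[OF that] s T by simp
      have 1: "A \<le> (1 + s) * T ^ 5" using A up[of 2] by simp
      have "(- b) * (2 * p) \<le> \<bar>b\<bar> * \<bar>2 * p\<bar>" by (metis abs_ge_self abs_minus_cancel abs_mult)
      also have "\<dots> \<le> T * ((1 + s) * T)" using b p T by (intro mult_mono) auto
      also have "\<dots> = (1 + s) * T\<^sup>2" by (simp add: power2_eq_square)
      also have "\<dots> \<le> (1 + s) * T ^ 5" using s pw[of 2 5] by (intro mult_left_mono) auto
      finally have 2: "(- b) * 2 * (2 * p) \<le> 2 * ((1 + s) * T ^ 5)" by simp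
      have "(2 * \<alpha>) * ((- b) * A) \<le> 1 * (T * T\<^sup>2)"
      proof (rule order_trans[OF mult_left_mono mult_right_mono])
        show "(- b) * A \<le> T * T\<^sup>2" using b A T by (intro mult_mono) auto
      qed (use \<alpha> T in auto)
      also have "\<dots> = T ^ 3" by (simp add: power2_eq_square power3_eq_cube)
      also have "\<dots> \<le> (1 + s) * T ^ 5" by (rule up) simp
      finally have 3: "(2 * \<alpha>) * ((- b) * A) \<le> (1 + s) * T ^ 5" .
      have "T ^ 3 * N \<le> T ^ 3 * (2 * (1 + s) * T\<^sup>2)" using N_le T by (intro mult_left_mono) auto
      also have "\<dots> = 2 * ((1 + s) * (T ^ 3 * T\<^sup>2))" by (simp only: mult_ac)
      also have "T ^ 3 * T\<^sup>2 = T ^ 5" by (simp flip: power_add)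
      finally have "10 * (T ^ 3 * N) \<le> 20 * ((1 + s) * T ^ 5)" by linarith
      then show "A + (- b) * 2 * (2 * p) + (2 * \<alpha>) * ((- b) * A) + 10 * (T ^ 3 * N) \<le> 24 * ((1 + s) * T ^ 5)"
        using 1 2 3 by linarith
    qed auto
    finally show ?thesis by simp
  qed
  have v1_le: "\<bar>v1\<bar> \<le> 3 * v * T"
  proof -
    have "\<bar>v1\<bar> \<le> \<bar>2 * p\<bar> + 2 * d * \<bar>b\<bar>" using d by (simp add: v1_def abs_mult order_trans[OF abs_triangle_ineq])
    also have "\<dots> \<le> (1 + s) * T + 2 * d * T" using p b d by (intro add_mono mult_left_mono) auto
    also have "\<dots> \<le> 3 * v * T"
      using s d T by (simp add: v_def distrib_right[symmetric] mult_right_mono)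
    finally show ?thesis .
  qed
  have b2: "b\<^sup>2 \<le> T\<^sup>2" using b T by (intro abs_le_square_iff[THEN iffD1]) auto
  have v2_le: "0 \<le> v2" "v2 \<le> 2 * v * T\<^sup>2"
  proof -
    show "0 \<le> v2" using A d by (simp add: v2_def)
    have "v2 \<le> T\<^sup>2 + d * T\<^sup>2" using A b2 d by (auto simp: v2_def intro!: add_mono mult_left_mono)
    also have "\<dots> = (1 + d) * T\<^sup>2" by (simp add: distrib_right)
    also have "\<dots> \<le> 2 * v * T\<^sup>2" using s d by (intro mult_right_mono) (auto simp: v_def)
    finally show "v2 \<le> 2 * v * T\<^sup>2" .
  qed
  have vT: "v * T \<le> v * T\<^sup>2" using v0 pw[of 1 2] by (intro mult_left_mono) auto
  have \<alpha>v2: "\<alpha> * v2 \<le> v * T\<^sup>2"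
    using mult_mono[of \<alpha> "1/2" v2 "2 * v * T\<^sup>2"] \<alpha> v2_le by simp
  have w_le: "\<bar>v1 + \<alpha> * v2\<bar> \<le> 4 * v * T\<^sup>2"
  proof -
    have "\<alpha> * v2 \<ge> 0" using \<alpha> v2_le by simp
    then show ?thesis using v1_le vT \<alpha>v2 by linarith
  qed
  have v'_le: "v' \<le> 3 * v * T\<^sup>2"
  proof -
    have "\<alpha> * (v1 + \<alpha> * v2) \<le> \<alpha> * (4 * v * T\<^sup>2)" using w_le \<alpha> by (intro mult_left_mono) auto
    also have "\<dots> \<le> 1/2 * (4 * v * T\<^sup>2)" using \<alpha> v0 T by (intro mult_right_mono) auto
    finally have "\<alpha> * v1 + \<alpha>\<^sup>2 * v2 \<le> 2 * v * T\<^sup>2" by (simp add: power2_eq_square algebra_simps)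
    moreover have "v * 1 \<le> v * T\<^sup>2" using v0 pw1 by (intro mult_left_mono) auto
    ultimately show ?thesis by (simp add: v')
  qed
  have H: "H \<ge> 1" "\<epsilon> * (1 + s) \<le> H" using \<epsilon> s by (auto simp: H_def distrib_left)
  have y1_le: "\<bar>y1\<bar> \<le> 3 * ((1 + s) * T)"
  proof -
    have "\<bar>y1\<bar> \<le> \<bar>2 * p\<bar> + 2 * (\<bar>b\<bar> * s)" using s by (simp add: y1_def abs_mult order_trans[OF abs_triangle_ineq4])
    also have "\<dots> \<le> (1 + s) * T + 2 * (T * (1 + s))" using p b s T by (intro add_mono mult_mono) auto
    finally show ?thesis by (simp add: algebra_simps)
  qed
  have ey: "\<epsilon> * \<bar>y1\<bar> \<le> 3 * H * T"
  proof -
    have "\<epsilon> * \<bar>y1\<bar> \<le> \<epsilon> * (3 * ((1 + s) * T))" using y1_le \<epsilon> by (intro mult_left_mono) auto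
    also have "\<dots> = 3 * (\<epsilon> * (1 + s)) * T" by simp
    also have "\<dots> \<le> 3 * H * T" using H T by (intro mult_right_mono mult_left_mono) auto
    finally show ?thesis .
  qed
  have vH: "0 \<le> v * H" using v0 H by simp
  have up: "v * H * T ^ i \<le> v * H * T ^ 7" if "i \<le> 7" for i
    using vH pw[OF that] by (rule mult_left_mono[rotated])
  have r1: "v2 * H \<le> 2 * (v * H * T ^ 7)"
  proof -
    have "v2 * H \<le> 2 * v * T\<^sup>2 * H" using v2_le H by (intro mult_right_mono) auto
    also have "\<dots> = 2 * (v * H * T ^ 2)" by simp
    finally show ?thesis using up[of 2] by simp
  qed
  have r2: "\<epsilon> * y1 * (v1 + \<alpha> * v2) \<le> 12 * (v * H * T ^ 7)"
  proof -
    have "\<epsilon> * y1 * (v1 + \<alpha> * v2) \<le> (\<epsilon> * \<bar>y1\<bar>) * \<bar>v1 + \<alpha> * v2\<bar>"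
      using \<epsilon> by (metis abs_ge_self abs_mult abs_of_pos)
    also have "\<dots> \<le> (3 * H * T) * (4 * v * T\<^sup>2)" using H T \<epsilon> by (intro mult_mono[OF ey w_le]) auto
    also have "\<dots> = 12 * (v * H * T ^ 3)" by (simp add: power2_eq_square power3_eq_cube)
    finally show ?thesis using up[of 3] by simp
  qed
  have r3: "24 * \<epsilon> * v' * ((1 + s) * T ^ 5) \<le> 72 * (v * H * T ^ 7)"
  proof -
    have "24 * \<epsilon> * v' * ((1 + s) * T ^ 5) = 24 * (v' * (\<epsilon> * (1 + s)) * T ^ 5)" by simp
    also have "\<dots> \<le> 24 * ((3 * v * T\<^sup>2) * H * T ^ 5)"
      using v'_le v'0 H \<epsilon> s T v0 by (intro mult_left_mono mult_right_mono mult_mono) auto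
    also have "\<dots> = 72 * (v * H * (T ^ 2 * T ^ 5))" by simp
    also have "\<dots> = 72 * (v * H * T ^ 7)" by (simp only: power_add[symmetric]) simp
    finally show ?thesis .
  qed
  have "v' * (1 + \<epsilon> * (N / (1 + \<alpha> * b)\<^sup>2)) \<le> v' * (H + \<epsilon> * (\<alpha> * y1 + 24 * \<alpha>\<^sup>2 * ((1 + s) * T ^ 5)))"
    using mult_left_mono[OF ratio, of \<epsilon>] \<epsilon> v'0 by (intro mult_left_mono) (auto simp: H_def distrib_left)
  also have "\<dots> = v * H + \<alpha> * (v1 * H + \<epsilon> * v * y1)
      + \<alpha>\<^sup>2 * (v2 * H + \<epsilon> * y1 * (v1 + \<alpha> * v2) + 24 * \<epsilon> * v' * ((1 + s) * T ^ 5))"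
    unfolding v' by (simp add: algebra_simps power2_eq_square)
  also have "\<dots> \<le> v * H + \<alpha> * (v1 * H + \<epsilon> * v * y1) + \<alpha>\<^sup>2 * (86 * (v * H * T ^ 7))"
    by (intro add_left_mono mult_left_mono) (use r1 r2 r3 in linarith, simp)
  also have "\<alpha>\<^sup>2 * (86 * (v * H * T ^ 7)) = 86 * \<alpha>\<^sup>2 * (v * H) * T ^ 7" by (simp only: mult_ac)
  finally show ?thesis unfolding v'_def H_def v1_def y1_def .
qed

text \<open>
The Lyapunov function \<open>V (1 + \<epsilon> \<xi>\<^sup>2)\<close> as a function of \<open>p = m - x\<^sup>*\<close> and \<open>\<sigma>\<close>.
\<close>

definition lyap :: "real \<Rightarrow> real ^ 'n \<Rightarrow> real \<Rightarrow> real" where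
  "lyap \<epsilon> p \<sigma> = ((norm p)\<^sup>2 + real CARD('n) * \<sigma>\<^sup>2) * (1 + \<epsilon> * ((norm p)\<^sup>2 / \<sigma>\<^sup>2))"

lemma lyap_nonneg: "\<epsilon> \<ge> 0 \<Longrightarrow> lyap \<epsilon> p \<sigma> \<ge> 0"
  unfolding lyap_def by (intro mult_nonneg_nonneg add_nonneg_nonneg) auto

text \<open>
Homogeneity reduces the contraction of \<open>L\<close> to the case \<open>\<sigma> = 1\<close>.
\<close>

lemma lyap_scale: "c > 0 \<Longrightarrow> lyap \<epsilon> (c *\<^sub>R p) (c * \<sigma>) = c\<^sup>2 * lyap \<epsilon> p \<sigma>"
  by (simp add: lyap_def power_mult_distrib distrib_left mult.left_commute)

section \<open>The normalised step\<close>

definition sample_weight :: "(nat \<Rightarrow> real) \<Rightarrow> nat \<Rightarrow> real ^ 'n \<Rightarrow> (nat \<Rightarrow> real ^ 'n) \<Rightarrow> nat \<Rightarrow> real" where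
  "sample_weight w lam \<mu> z = tie_weight {1..lam} w (\<lambda>j. norm (\<mu> + z j))"

definition mean_step :: "(nat \<Rightarrow> real) \<Rightarrow> nat \<Rightarrow> real ^ 'n \<Rightarrow> (nat \<Rightarrow> real ^ 'n) \<Rightarrow> real ^ 'n" where
  "mean_step w lam \<mu> z = (\<Sum>i = 1..lam. sample_weight w lam \<mu> z i *\<^sub>R z i)"

definition size_step :: "(nat \<Rightarrow> real) \<Rightarrow> nat \<Rightarrow> real ^ 'n \<Rightarrow> (nat \<Rightarrow> real ^ 'n) \<Rightarrow> real" where
  "size_step w lam \<mu> z =
     (\<Sum>i = 1..lam. sample_weight w lam \<mu> z i * (((norm (z i))\<^sup>2 - real CARD('n)) / (2 * real CARD('n))))"

text \<open>
The variable \<open>T\<close> that dominates \<open>\<parallel>a\<parallel>\<close> and \<open>\<bar>b\<bar>\<close>.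
\<close>

definition dominator :: "nat \<Rightarrow> (nat \<Rightarrow> real ^ 'n) \<Rightarrow> real" where
  "dominator lam z = 1 + (\<Sum>i = 1..lam. (norm (z i))\<^sup>2)"

lemma increment_affine:
  fixes m xs :: "real ^ 'n"
  assumes nu: "strict_mono \<nu>" and f: "f = (\<lambda>x. \<nu> (norm (x - xs)))" and \<sigma>: "\<sigma> > 0"
  shows "increment f w lam (m, \<sigma>) (\<lambda>i. m + \<sigma> *\<^sub>R z i)
    = (\<sigma> *\<^sub>R mean_step w lam ((m - xs) /\<^sub>R \<sigma>) z, \<sigma> * size_step w lam ((m - xs) /\<^sub>R \<sigma>) z)"
proof -
  let ?\<mu> = "(m - xs) /\<^sub>R \<sigma>"
  have nrm: "norm (m + \<sigma> *\<^sub>R y - xs) = \<sigma> * norm (?\<mu> + y)" for y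
  proof -
    have "m + \<sigma> *\<^sub>R y - xs = \<sigma> *\<^sub>R (?\<mu> + y)" using \<sigma> by (simp add: scaleR_add_right)
    then show ?thesis using \<sigma> by simp
  qed
  have W: "rank_weight f w lam (\<lambda>i. m + \<sigma> *\<^sub>R z i) = sample_weight w lam ?\<mu> z"
    unfolding rank_weight_eq_tie_weight[abs_def] sample_weight_def
    using \<sigma> strict_mono_less[OF nu]
    by (intro tie_weight_strict_mono_comp) (simp add: f nrm)
  have size: "1 / (2 * real CARD('n) * \<sigma>) * ((norm (\<sigma> *\<^sub>R y))\<^sup>2 - real CARD('n) * \<sigma>\<^sup>2)
      = \<sigma> * (((norm y)\<^sup>2 - real CARD('n)) / (2 * real CARD('n)))" for y :: "real ^ 'n"
    using \<sigma> by (simp add: power_mult_distrib field_simps power2_eq_square)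
  have dir: "search_dir (m, \<sigma>) (m + \<sigma> *\<^sub>R y)
      = (\<sigma> *\<^sub>R y, \<sigma> * (((norm y)\<^sup>2 - real CARD('n)) / (2 * real CARD('n))))" for y
    unfolding search_dir_def Let_def fst_conv snd_conv add_diff_cancel_left' size ..
  show ?thesis
    unfolding increment_def dir W mean_step_def size_step_def scaleR_sum_right sum_distrib_left
      scaleR_Pair sum_prod
    by (intro arg_cong2[where f=Pair] sum.cong refl) (simp_all add: mult.commute mult.left_commute)
qed

text \<open>
Normalised weights that favour better samples strictly somewhere.
\<close>

locale selection_weights =
  fixes lam :: nat and w :: "nat \<Rightarrow> real"
  assumes lam: "lam \<ge> 2"
    and W1: "\<forall>i\<in>{1..lam}. w i \<ge> 0" "(\<Sum>i = 1..lam. w i) = 1"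
    and W2: "\<forall>i\<in>{1..<lam}. w i \<ge> w (i + 1)" "\<exists>i\<in>{1..<lam}. w i > w (i + 1)"
begin

lemma w_antimono: "1 \<le> p \<Longrightarrow> p \<le> q \<Longrightarrow> q \<le> lam \<Longrightarrow> w q \<le> w p"
proof (induction q)
  case (Suc n)
  show ?case
  proof (cases "p = Suc n")
    case False
    then have "w (n + 1) \<le> w n" using Suc.prems W2(1) by auto
    then show ?thesis using Suc False by simp
  qed simp
qed simp

text \<open>
The best sample receives more than the average weight; this is the source of strict progress.
\<close>

lemma w_first_gt: "real lam * w 1 > 1"
proof -
  obtain i where i: "i \<in> {1..<lam}" "w i > w (i + 1)" using W2(2) by blast
  have "(\<Sum>j = 1..lam. w j) < (\<Sum>j = 1..lam. w 1)"
  proof (rule sum_strict_mono_ex1)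
    show "\<forall>j\<in>{1..lam}. w j \<le> w 1" using w_antimono[of 1] by auto
    have "w (i + 1) < w 1" using i w_antimono[of 1 i] by auto
    then show "\<exists>j\<in>{1..lam}. w j < w 1" using i by (intro bexI[of _ "i + 1"]) auto
  qed auto
  then show ?thesis using W1(2) by simp
qed

lemma sample_weight_nonneg: "i \<in> {1..lam} \<Longrightarrow> sample_weight w lam \<mu> z i \<ge> 0"
  unfolding sample_weight_def using W1 by (intro tie_weight_nonneg) auto

lemma sum_sample_weight: "(\<Sum>i = 1..lam. sample_weight w lam \<mu> z i) = 1"
  unfolding sample_weight_def using sum_tie_weight[of "{1..lam}" w "\<lambda>j. norm (\<mu> + z j)"] W1(2) by simp

text \<open>
The form in which the simplifier presents the index set.
\<close>

lemmas sum_sample_weight' = sum_sample_weight[unfolded One_nat_def]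

lemma sample_weight_average_le:
  assumes "\<And>i. i \<in> {1..lam} \<Longrightarrow> q i \<le> c"
  shows "(\<Sum>i = 1..lam. sample_weight w lam \<mu> z i * q i) \<le> c"
proof -
  have "(\<Sum>i = 1..lam. sample_weight w lam \<mu> z i * q i) \<le> (\<Sum>i = 1..lam. sample_weight w lam \<mu> z i * c)"
    using assms by (intro sum_mono mult_left_mono sample_weight_nonneg) auto
  then show ?thesis by (simp add: sum_distrib_right[symmetric] sum_sample_weight')
qed

lemma dominator_ge: "dominator lam z \<ge> 1" "i \<in> {1..lam} \<Longrightarrow> 1 + (norm (z i))\<^sup>2 \<le> dominator lam z"
  unfolding dominator_def
  using member_le_sum[of i "{1..lam}" "\<lambda>i. (norm (z i))\<^sup>2"] by (auto simp: sum_nonneg)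

lemma norm_mean_step_le: "norm (mean_step w lam \<mu> z) \<le> dominator lam z"
proof -
  have "norm (mean_step w lam \<mu> z) \<le> (\<Sum>i = 1..lam. sample_weight w lam \<mu> z i * norm (z i))"
    unfolding mean_step_def by (rule order_trans[OF norm_sum]) (simp add: sample_weight_nonneg)
  also have "\<dots> \<le> dominator lam z"
  proof (rule sample_weight_average_le)
    fix i assume "i \<in> {1..lam}"
    moreover have "norm (z i) \<le> 1 + (norm (z i))\<^sup>2"
      using sum_squares_bound[of "norm (z i)" 1] norm_ge_zero[of "z i"] by (simp del: norm_ge_zero)
    ultimately show "norm (z i) \<le> dominator lam z" using dominator_ge(2)[of i z] by linarith
  qed
  finally show ?thesis .
qed

lemma inner_mean_step_le: "\<bar>2 * (\<mu> \<bullet> mean_step w lam \<mu> z)\<bar> \<le> (1 + (norm \<mu>)\<^sup>2) * dominator lam z"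
proof -
  let ?a = "mean_step w lam \<mu> z" and ?T = "dominator lam z"
  have "\<bar>2 * (\<mu> \<bullet> ?a)\<bar> \<le> 2 * (norm \<mu> * norm ?a)" using Cauchy_Schwarz_ineq2[of \<mu> ?a] by simp
  also have "\<dots> \<le> 2 * (norm \<mu> * ?T)" by (intro mult_left_mono norm_mean_step_le) auto
  also have "\<dots> = 2 * norm \<mu> * 1 * ?T" by simp
  also have "\<dots> \<le> (1 + (norm \<mu>)\<^sup>2) * ?T"
    using sum_squares_bound[of "norm \<mu>" 1] dominator_ge(1)[of z] by (intro mult_right_mono) auto
  finally show ?thesis .
qed

text \<open>
Since \<open>\<parallel>z\<^sub>i\<parallel>\<^sup>2 - d \<ge> - d\<close> and the weights sum to 1, the step-size factor \<open>1 + \<alpha> b\<close> is at least \<open>1 - \<alpha> / 2\<close>.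
\<close>

lemma size_step_ge: "size_step w lam \<mu> (z :: nat \<Rightarrow> real ^ 'n) \<ge> -1/2"
proof -
  have "(\<Sum>i = 1..lam. sample_weight w lam \<mu> z i * (- (((norm (z i))\<^sup>2 - real CARD('n)) / (2 * real CARD('n))))) \<le> 1/2"
    by (rule sample_weight_average_le) (simp add: field_simps)
  then show ?thesis by (simp add: size_step_def sum_negf)
qed

lemma size_step_le: "\<bar>size_step w lam \<mu> (z :: nat \<Rightarrow> real ^ 'n)\<bar> \<le> dominator lam z"
proof -
  have d: "real CARD('n) \<ge> 1" by (simp add: Suc_leI)
  have "size_step w lam \<mu> z \<le> dominator lam z" unfolding size_step_def
  proof (rule sample_weight_average_le)
    fix i assume i: "i \<in> {1..lam}"
    have "((norm (z i))\<^sup>2 - real CARD('n)) / (2 * real CARD('n)) \<le> (norm (z i))\<^sup>2 / (2 * real CARD('n))"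
      by (intro divide_right_mono) auto
    also have "\<dots> \<le> (norm (z i))\<^sup>2 / 1" by (intro divide_left_mono) (use d in linarith, simp_all)
    also have "\<dots> \<le> dominator lam z" using dominator_ge(2)[OF i, of z] by simp
    finally show "((norm (z i))\<^sup>2 - real CARD('n)) / (2 * real CARD('n)) \<le> dominator lam z" .
  qed
  then show ?thesis using size_step_ge[of \<mu> z] dominator_ge(1)[of z] by simp
qed

text \<open>
The coefficients of \<open>\<alpha>\<close> in \<open>V\<close> and in \<open>\<xi>\<^sup>2\<close> after one step from \<open>\<sigma> = 1\<close>.
\<close>

definition V_rate :: "real ^ 'n \<Rightarrow> (nat \<Rightarrow> real ^ 'n) \<Rightarrow> real" where
  "V_rate \<mu> z = 2 * (\<mu> \<bullet> mean_step w lam \<mu> z) + 2 * real CARD('n) * size_step w lam \<mu> z"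

definition xi_sq_rate :: "real ^ 'n \<Rightarrow> (nat \<Rightarrow> real ^ 'n) \<Rightarrow> real" where
  "xi_sq_rate \<mu> z = 2 * (\<mu> \<bullet> mean_step w lam \<mu> z) - 2 * size_step w lam \<mu> z * (norm \<mu>)\<^sup>2"

lemma xi_sq_rate_le: "xi_sq_rate \<mu> (z :: nat \<Rightarrow> real ^ 'n) \<le> 3 * (1 + (norm \<mu>)\<^sup>2) * dominator lam z"
proof -
  have "- size_step w lam \<mu> z * (norm \<mu>)\<^sup>2 \<le> dominator lam z * (norm \<mu>)\<^sup>2"
    using size_step_le[of \<mu> z] by (intro mult_right_mono) auto
  then show ?thesis
    using inner_mean_step_le[of \<mu> z] dominator_ge(1)[of z] by (simp add: xi_sq_rate_def algebra_simps)
qed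

text \<open>
By \<open>2 (\<mu> \<bullet> z) + \<parallel>z\<parallel>\<^sup>2 - d = \<parallel>\<mu> + z\<parallel>\<^sup>2 - (\<parallel>\<mu>\<parallel>\<^sup>2 + d)\<close>, the rate of \<open>V\<close> compares the weighted mean of the
squared distances to the optimum with their expectation \<open>\<parallel>\<mu>\<parallel>\<^sup>2 + d\<close>.
\<close>

lemma V_rate_eq:
  fixes \<mu> :: "real ^ 'n"
  shows "V_rate \<mu> z = (\<Sum>i = 1..lam. sample_weight w lam \<mu> z i * (norm (\<mu> + z i))\<^sup>2) - ((norm \<mu>)\<^sup>2 + real CARD('n))"
proof -
  have "(norm (\<mu> + y))\<^sup>2 = 2 * (\<mu> \<bullet> y) + 2 * real CARD('n) * (((norm y)\<^sup>2 - real CARD('n)) / (2 * real CARD('n)))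
      + ((norm \<mu>)\<^sup>2 + real CARD('n))" for y :: "real ^ 'n"
    by (simp add: power2_norm_eq_inner inner_add_left inner_add_right inner_commute)
  then have "(\<Sum>i = 1..lam. sample_weight w lam \<mu> z i * (norm (\<mu> + z i))\<^sup>2)
     = (\<Sum>i = 1..lam. 2 * (sample_weight w lam \<mu> z i * (\<mu> \<bullet> z i))
        + 2 * real CARD('n) * (sample_weight w lam \<mu> z i * (((norm (z i))\<^sup>2 - real CARD('n)) / (2 * real CARD('n))))
        + sample_weight w lam \<mu> z i * ((norm \<mu>)\<^sup>2 + real CARD('n)))"
    by (simp only: distrib_left mult.left_commute)
  also have "\<dots> = V_rate \<mu> z + (\<Sum>i = 1..lam. sample_weight w lam \<mu> z i) * ((norm \<mu>)\<^sup>2 + real CARD('n))"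
    unfolding sum.distrib V_rate_def mean_step_def size_step_def inner_sum_right inner_scaleR_right
      sum_distrib_left[symmetric] sum_distrib_right ..
  finally show ?thesis by (simp add: sum_sample_weight')
qed

lemma sample_weight_antimono:
  "i \<in> {1..lam} \<Longrightarrow> j \<in> {1..lam} \<Longrightarrow> (norm (\<mu> + z i))\<^sup>2 < (norm (\<mu> + z j))\<^sup>2 \<Longrightarrow> sample_weight w lam \<mu> z j \<le> sample_weight w lam \<mu> z i"
  unfolding sample_weight_def
  by (rule tie_weight_antimono) (use w_antimono in \<open>auto intro: power2_less_imp_less\<close>)

lemma V_rate_le:
  fixes \<mu> :: "real ^ 'n"
  shows "real lam * V_rate \<mu> z \<le> (\<Sum>i = 1..lam. (norm (\<mu> + z i))\<^sup>2) - real lam * ((norm \<mu>)\<^sup>2 + real CARD('n))"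
  using chebyshev_sum[of "{1..lam}" "\<lambda>i. (norm (\<mu> + z i))\<^sup>2" "sample_weight w lam \<mu> z", OF sample_weight_antimono]
  by (simp add: V_rate_eq sum_sample_weight' right_diff_distrib)

text \<open>
The bound \<open>2 \<eta> + 2\<close> puts the other samples at distance at least \<open>\<eta> + 2\<close> from \<open>- \<mu>\<close>, whereas the first one
is within \<open>\<eta> + 1\<close>. So the first sample is ranked best and the squared distances differ by at least 1.
\<close>

lemma V_rate_le_separated:
  fixes \<mu> :: "real ^ 'n"
  assumes \<mu>: "norm \<mu> \<le> \<eta>" and z1: "norm (z 1) < 1"
    and z: "\<And>i. i \<in> {1..lam} \<Longrightarrow> i \<noteq> 1 \<Longrightarrow> norm (z i) > 2 * \<eta> + 2"
  shows "real lam * V_rate \<mu> z \<le> (\<Sum>i = 1..lam. (norm (\<mu> + z i))\<^sup>2) - real lam * ((norm \<mu>)\<^sup>2 + real CARD('n))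
     - (real lam * w 1 - 1) / 2"
proof -
  have gap: "(norm (\<mu> + z i))\<^sup>2 \<ge> (norm (\<mu> + z 1))\<^sup>2 + 1" if "i \<in> {1..lam}" "i \<noteq> 1" for i
  proof -
    have 1: "norm (\<mu> + z 1) \<le> \<eta> + 1" using norm_triangle_ineq[of \<mu> "z 1"] \<mu> z1 by linarith
    have "norm (z i) \<le> norm (\<mu> + z i) + norm \<mu>" using norm_triangle_ineq4[of "\<mu> + z i" \<mu>] by simp
    then have 2: "norm (\<mu> + z i) \<ge> \<eta> + 2" using z[OF that] \<mu> by linarith
    have \<eta>: "\<eta> \<ge> 0" using norm_ge_zero[of \<mu>] \<mu> by linarith
    have "(norm (\<mu> + z 1))\<^sup>2 + 1 \<le> (\<eta> + 1)\<^sup>2 + 1" using 1 by (intro add_right_mono power_mono) auto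
    also have "\<dots> \<le> (\<eta> + 2)\<^sup>2" using \<eta> by (simp add: power2_eq_square algebra_simps)
    also have "\<dots> \<le> (norm (\<mu> + z i))\<^sup>2" using 2 \<eta> by (intro power_mono) auto
    finally show ?thesis .
  qed
  have "sample_weight w lam \<mu> z 1 = w 1" unfolding sample_weight_def
  proof (rule tie_weight_best)
    fix j assume "j \<in> {1..lam}" "j \<noteq> 1"
    from gap[OF this] have "(norm (\<mu> + z 1))\<^sup>2 < (norm (\<mu> + z j))\<^sup>2" by linarith
    then show "norm (\<mu> + z 1) < norm (\<mu> + z j)" by (rule power2_less_imp_less) simp
  qed
  then show ?thesis
    using chebyshev_sum_gap[of "{1..lam}" 1 "\<lambda>i. (norm (\<mu> + z i))\<^sup>2" "sample_weight w lam \<mu> z" 1, OF _ _ sample_weight_antimono _ gap] lam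
    by (simp add: V_rate_eq sum_sample_weight' right_diff_distrib diff_divide_distrib)
qed

end

section \<open>Drift of the Lyapunov function\<close>

context selection_weights begin

lemma measurable_sample_weight [measurable]:
  "i \<in> {1..lam} \<Longrightarrow> (\<lambda>z. sample_weight w lam \<mu> z i) \<in> borel_measurable (samples lam (0 :: real ^ 'n, 1))"
  unfolding sample_weight_def by (intro measurable_tie_weight) measurable

lemma measurable_mean_step [measurable]:
  "mean_step w lam \<mu> \<in> borel_measurable (samples lam (0 :: real ^ 'n, 1))"
  unfolding mean_step_def[abs_def] by measurable

lemma measurable_size_step [measurable]:
  "size_step w lam \<mu> \<in> borel_measurable (samples lam (0 :: real ^ 'n, 1))"
  unfolding size_step_def[abs_def] by measurable

lemma integrable_dominator: "integrable (samples lam (0 :: real ^ 'n, 1)) (\<lambda>z. dominator lam z ^ k)"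
  unfolding dominator_def by (rule integrable_samples_moment)

lemma integrable_mean_step: "integrable (samples lam (0 :: real ^ 'n, 1)) (mean_step w lam \<mu>)"
  by (rule Bochner_Integration.integrable_bound[OF integrable_dominator[of 1]])
    (auto intro!: AE_I2 order_trans[OF norm_mean_step_le])

lemma integrable_size_step: "integrable (samples lam (0 :: real ^ 'n, 1)) (size_step w lam \<mu>)"
  by (rule Bochner_Integration.integrable_bound[OF integrable_dominator[of 1]])
    (auto intro!: AE_I2 order_trans[OF size_step_le])

definition V_drift :: "real ^ 'n \<Rightarrow> real" where
  "V_drift \<mu> = (\<integral>z. V_rate \<mu> z \<partial>samples lam (0, 1))"

definition xi_sq_drift :: "real ^ 'n \<Rightarrow> real" where
  "xi_sq_drift \<mu> = (\<integral>z. xi_sq_rate \<mu> z \<partial>samples lam (0, 1))"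

lemma integrable_V_rate: "integrable (samples lam (0 :: real ^ 'n, 1)) (V_rate \<mu>)"
  unfolding V_rate_def[abs_def]
  by (intro Bochner_Integration.integrable_add integrable_mult_right integrable_inner_right
      integrable_mean_step integrable_size_step)

lemma integrable_xi_sq_rate: "integrable (samples lam (0 :: real ^ 'n, 1)) (xi_sq_rate \<mu>)"
  unfolding xi_sq_rate_def[abs_def]
  by (intro Bochner_Integration.integrable_diff integrable_mult_right integrable_mult_left
      integrable_inner_right integrable_mean_step integrable_size_step)

lemma xi_sq_drift_eq:
  fixes \<mu> :: "real ^ 'n"
  shows "xi_sq_drift \<mu> = 2 * (\<mu> \<bullet> (\<integral>z. mean_step w lam \<mu> z \<partial>samples lam (0, 1)))
     - 2 * (\<integral>z. size_step w lam \<mu> z \<partial>samples lam (0, 1)) * (norm \<mu>)\<^sup>2"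
  unfolding xi_sq_drift_def xi_sq_rate_def
  by (subst Bochner_Integration.integral_diff)
    (simp_all add: integrable_mean_step integrable_size_step integrable_mult_left)

lemma centred_norm_squares:
  fixes \<mu> :: "real ^ 'n"
  shows "integrable (samples lam (0, 1)) (\<lambda>z. (\<Sum>i = 1..lam. (norm (\<mu> + z i))\<^sup>2) - real lam * ((norm \<mu>)\<^sup>2 + real CARD('n)))"
    and "(\<integral>z. (\<Sum>i = 1..lam. (norm (\<mu> + z i))\<^sup>2) - real lam * ((norm \<mu>)\<^sup>2 + real CARD('n)) \<partial>samples lam (0, 1)) = 0"
proof -
  interpret prob_space "samples lam (0 :: real ^ 'n, 1)" by (rule prob_space_samples) simp
  have 1: "has_bochner_integral (samples lam (0, 1)) (\<lambda>z. \<Sum>i = 1..lam. (norm (\<mu> + z i))\<^sup>2)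
      (\<Sum>i = 1..lam. ((norm \<mu>)\<^sup>2 + real CARD('n)))"
    by (rule has_bochner_integral_sum) (rule has_bochner_integral_samples_norm_square)
  have 2: "has_bochner_integral (samples lam (0 :: real ^ 'n, 1)) (\<lambda>z. real lam * ((norm \<mu>)\<^sup>2 + real CARD('n)))
     (real lam * ((norm \<mu>)\<^sup>2 + real CARD('n)))"
    by (simp add: has_bochner_integral_iff prob_space)
  from has_bochner_integral_diff[OF 1 2]
  show "integrable (samples lam (0, 1)) (\<lambda>z. (\<Sum>i = 1..lam. (norm (\<mu> + z i))\<^sup>2) - real lam * ((norm \<mu>)\<^sup>2 + real CARD('n)))"
    "(\<integral>z. (\<Sum>i = 1..lam. (norm (\<mu> + z i))\<^sup>2) - real lam * ((norm \<mu>)\<^sup>2 + real CARD('n)) \<partial>samples lam (0, 1)) = 0"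
    by (simp_all add: has_bochner_integral_iff)
qed

lemma V_drift_nonpos: "V_drift (\<mu> :: real ^ 'n) \<le> 0"
proof -
  have "real lam * V_drift \<mu> = (\<integral>z. real lam * V_rate \<mu> z \<partial>samples lam (0, 1))"
    by (simp add: V_drift_def)
  also have "\<dots> \<le> (\<integral>z. (\<Sum>i = 1..lam. (norm (\<mu> + z i))\<^sup>2) - real lam * ((norm \<mu>)\<^sup>2 + real CARD('n)) \<partial>samples lam (0, 1))"
    by (intro integral_mono integrable_mult_right integrable_V_rate centred_norm_squares V_rate_le)
  also have "\<dots> = 0" by (rule centred_norm_squares)
  finally show ?thesis using lam by (simp add: mult_le_0_iff)
qed

text \<open>
The improvement on the separated event, multiplied by the probability of that event.
\<close>

lemma V_drift_uniformly_negative: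
  fixes \<eta> :: real
  shows "\<exists>c>0. \<forall>\<mu> :: real ^ 'n. norm \<mu> \<le> \<eta> \<longrightarrow> V_drift \<mu> \<le> - c"
proof -
  interpret prob_space "samples lam (0 :: real ^ 'n, 1)" by (rule prob_space_samples) simp
  define A where "A = (\<lambda>i::nat. if i = 1 then ball 0 1 else - cball (0 :: real ^ 'n) (2 * \<eta> + 2))"
  define B where "B = Pi\<^sub>E {1..lam} A"
  have B: "prob B > 0" "B \<in> events"
    using samples_separated_event_pos[of lam "2 * \<eta> + 2", where 'n='n] by (simp_all add: A_def B_def)
  define c where "c = (real lam * w 1 - 1) / 2 * prob B / real lam"
  have "c > 0" using B w_first_gt lam by (simp add: c_def)
  moreover have "V_drift \<mu> \<le> - c" if \<mu>: "norm \<mu> \<le> \<eta>" for \<mu> :: "real ^ 'n"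
  proof -
    let ?C = "\<lambda>z. (\<Sum>i = 1..lam. (norm (\<mu> + z i))\<^sup>2) - real lam * ((norm \<mu>)\<^sup>2 + real CARD('n))"
    let ?I = "\<lambda>z. (real lam * w 1 - 1) / 2 * indicat_real B z"
    have I: "integrable (samples lam (0, 1)) ?I"
      using B by (intro integrable_mult_right integrable_real_indicator) (auto simp: emeasure_eq_measure)
    have "real lam * V_drift \<mu> = (\<integral>z. real lam * V_rate \<mu> z \<partial>samples lam (0, 1))"
      by (simp add: V_drift_def)
    also have "\<dots> \<le> (\<integral>z. ?C z - ?I z \<partial>samples lam (0, 1))"
    proof (rule integral_mono)
      show "integrable (samples lam (0, 1)) (\<lambda>z. real lam * V_rate \<mu> z)"
        by (intro integrable_mult_right integrable_V_rate)
      show "integrable (samples lam (0, 1)) (\<lambda>z. ?C z - ?I z)"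
        by (intro Bochner_Integration.integrable_diff centred_norm_squares I)
      fix z :: "nat \<Rightarrow> real ^ 'n"
      show "real lam * V_rate \<mu> z \<le> ?C z - ?I z"
      proof (cases "z \<in> B")
        case True
        have z: "z i \<in> A i" if "i \<in> {1..lam}" for i using True that unfolding B_def by (rule PiE_mem)
        have "real lam * V_rate \<mu> z \<le> ?C z - (real lam * w 1 - 1) / 2"
        proof (rule V_rate_le_separated[OF \<mu>])
          show "norm (z 1) < 1" using z[of 1] lam by (simp add: A_def)
          show "norm (z i) > 2 * \<eta> + 2" if "i \<in> {1..lam}" "i \<noteq> 1" for i
            using z[OF that(1)] that(2) by (simp add: A_def)
        qed
        then show ?thesis using True by simp
      qed (use V_rate_le[of \<mu> z] in simp)
    qed
    also have "\<dots> = - (real lam * c)"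
      using B lam unfolding Bochner_Integration.integral_diff[OF centred_norm_squares(1) I] centred_norm_squares(2)
      by (simp add: c_def)
    finally have "real lam * V_drift \<mu> \<le> real lam * (- c)" by simp
    then show ?thesis by (rule mult_left_le_imp_le) (use lam in simp)
  qed
  ultimately show ?thesis by blast
qed

lemma lyap_step_le:
  fixes \<mu> :: "real ^ 'n"
  assumes \<alpha>: "0 < \<alpha>" "\<alpha> \<le> 1/2" and \<epsilon>: "0 < \<epsilon>" "\<epsilon> \<le> 1"
  shows "lyap \<epsilon> (\<mu> + \<alpha> *\<^sub>R mean_step w lam \<mu> z) (1 + \<alpha> * size_step w lam \<mu> z)
    \<le> lyap \<epsilon> \<mu> 1
      + \<alpha> * (V_rate \<mu> z * (1 + \<epsilon> * (norm \<mu>)\<^sup>2) + \<epsilon> * ((norm \<mu>)\<^sup>2 + real CARD('n)) * xi_sq_rate \<mu> z)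
      + 86 * \<alpha>\<^sup>2 * lyap \<epsilon> \<mu> 1 * dominator lam z ^ 7"
proof -
  let ?a = "mean_step w lam \<mu> z" and ?b = "size_step w lam \<mu> z" and ?T = "dominator lam z"
  let ?p = "\<mu> \<bullet> ?a"
  have d: "real CARD('n) \<ge> 1" by (simp add: Suc_leI)
  have N: "(norm (\<mu> + \<alpha> *\<^sub>R ?a))\<^sup>2 = (norm \<mu>)\<^sup>2 + 2 * \<alpha> * ?p + \<alpha>\<^sup>2 * (norm ?a)\<^sup>2"
    unfolding power2_norm_eq_inner
    by (simp add: inner_add_left inner_add_right inner_commute power2_eq_square algebra_simps)
  have A: "(norm ?a)\<^sup>2 \<le> ?T\<^sup>2" by (intro power_mono norm_mean_step_le) auto
  show ?thesis
    using lyapunov_step_expansion[where s="(norm \<mu>)\<^sup>2" and p="?p" and b="?b" and T="?T",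
        OF _ d \<alpha> \<epsilon> dominator_ge(1) inner_mean_step_le _ A size_step_le size_step_ge]
    by (simp add: lyap_def N[symmetric] V_rate_def xi_sq_rate_def)
qed

text \<open>
The drift condition for \<open>L\<close>. For \<open>\<parallel>\<mu>\<parallel> \<ge> \<eta>\<close> the decrease of \<open>\<xi>\<^sup>2\<close> suffices, since \<open>\<epsilon> \<xi>\<^sup>2\<close> is there a fixed
proportion of \<open>1 + \<epsilon> \<xi>\<^sup>2\<close>. For \<open>\<parallel>\<mu>\<parallel> < \<eta>\<close> the decrease of \<open>V\<close> absorbs the bounded drift of \<open>\<epsilon> \<xi>\<^sup>2\<close>.
\<close>

lemma first_order_drift:
  fixes \<eta> C :: real
  assumes \<eta>: "\<eta> > 0" and C: "C > 0"
    and xi: "\<And>\<mu> :: real ^ 'n. norm \<mu> \<ge> \<eta> \<Longrightarrow> xi_sq_drift \<mu> \<le> - C * (norm \<mu>)\<^sup>2"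
  shows "\<exists>\<epsilon> \<kappa>. 0 < \<epsilon> \<and> \<epsilon> \<le> 1 \<and> 0 < \<kappa> \<and> (\<forall>\<mu> :: real ^ 'n.
     V_drift \<mu> * (1 + \<epsilon> * (norm \<mu>)\<^sup>2) + \<epsilon> * ((norm \<mu>)\<^sup>2 + real CARD('n)) * xi_sq_drift \<mu> \<le> - \<kappa> * lyap \<epsilon> \<mu> 1)"
proof -
  let ?d = "real CARD('n)"
  define M where "M = (\<integral>z. dominator lam z \<partial>samples lam (0 :: real ^ 'n, 1))"
  have intT: "integrable (samples lam (0 :: real ^ 'n, 1)) (dominator lam)"
    using integrable_dominator[of 1] by simp
  have M: "M \<ge> 1"
  proof -
    interpret prob_space "samples lam (0 :: real ^ 'n, 1)" by (rule prob_space_samples) simp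
    have "(\<integral>z. 1 \<partial>samples lam (0 :: real ^ 'n, 1)) \<le> M"
      unfolding M_def by (intro integral_mono intT dominator_ge) auto
    then show ?thesis by (simp add: prob_space)
  qed
  have G: "xi_sq_drift \<mu> \<le> 3 * (1 + (norm \<mu>)\<^sup>2) * M" for \<mu> :: "real ^ 'n"
  proof -
    have "xi_sq_drift \<mu> \<le> (\<integral>z. 3 * (1 + (norm \<mu>)\<^sup>2) * dominator lam z \<partial>samples lam (0 :: real ^ 'n, 1))"
      unfolding xi_sq_drift_def
      by (rule integral_mono[OF integrable_xi_sq_rate _ xi_sq_rate_le]) (intro integrable_mult_right intT)
    then show ?thesis by (simp add: M_def)
  qed
  obtain c where c: "c > 0" "\<And>\<mu> :: real ^ 'n. norm \<mu> \<le> \<eta> \<Longrightarrow> V_drift \<mu> \<le> - c"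
    using V_drift_uniformly_negative[of \<eta>, where 'n='n] by blast
  define c' where "c' = c / (\<eta>\<^sup>2 + ?d)"
  have d: "?d \<ge> 1" by (simp add: Suc_leI)
  have c': "c' > 0" using c d by (simp add: c'_def add_nonneg_pos)
  \<comment> \<open>The drift of \<open>\<epsilon> \<xi>\<^sup>2\<close> for \<open>\<parallel>\<mu>\<parallel> < \<eta>\<close> is then at most half of the decrease of \<open>V\<close>.\<close>
  define \<epsilon> where "\<epsilon> = min 1 (c' / (6 * (1 + \<eta>\<^sup>2) * M))"
  have \<epsilon>: "0 < \<epsilon>" "\<epsilon> \<le> 1" using c' M by (auto simp: \<epsilon>_def add_pos_nonneg)
  \<comment> \<open>The relative decrease of \<open>L\<close> for \<open>\<parallel>\<mu>\<parallel> < \<eta>\<close> and for \<open>\<parallel>\<mu>\<parallel> \<ge> \<eta>\<close>, respectively.\<close>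
  define \<kappa> where "\<kappa> = min (c' / 2) (C * (\<epsilon> * \<eta>\<^sup>2 / (1 + \<epsilon> * \<eta>\<^sup>2)))"
  have e0: "1 + \<epsilon> * s > 0" if "s \<ge> 0" for s using \<epsilon> that by (intro add_pos_nonneg) auto
  have \<kappa>: "0 < \<kappa>" using c' C \<epsilon> \<eta> e0[of "\<eta>\<^sup>2"] by (auto simp: \<kappa>_def)
  show ?thesis
  proof (intro exI conjI allI)
    fix \<mu> :: "real ^ 'n"
    define s where "s = (norm \<mu>)\<^sup>2"
    define v where "v = s + ?d"
    have s: "s \<ge> 0" by (simp add: s_def)
    have v: "v \<ge> 1" using s d unfolding v_def by linarith
    have lyap: "lyap \<epsilon> \<mu> 1 = v * (1 + \<epsilon> * s)" by (simp add: lyap_def s_def v_def)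
    have "V_drift \<mu> * (1 + \<epsilon> * s) + \<epsilon> * v * xi_sq_drift \<mu> \<le> - \<kappa> * (v * (1 + \<epsilon> * s))"
    proof (cases "norm \<mu> \<ge> \<eta>")
      case True
      have s\<eta>: "\<eta>\<^sup>2 \<le> s" unfolding s_def using True \<eta> by (intro power_mono) auto
      have "\<epsilon> * \<eta>\<^sup>2 / (1 + \<epsilon> * \<eta>\<^sup>2) \<le> \<epsilon> * s / (1 + \<epsilon> * s)"
      proof -
        have "x / (1 + x) \<le> y / (1 + y)" if "0 \<le> x" "x \<le> y" for x y :: real
          using that by (simp add: frac_le_eq divide_le_0_iff algebra_simps)
        then show ?thesis using s\<eta> \<epsilon> by simp
      qed
      then have "C * (\<epsilon> * \<eta>\<^sup>2 / (1 + \<epsilon> * \<eta>\<^sup>2)) \<le> C * (\<epsilon> * s / (1 + \<epsilon> * s))" using C by (intro mult_left_mono) auto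
      then have "\<kappa> * (1 + \<epsilon> * s) \<le> C * (\<epsilon> * s / (1 + \<epsilon> * s)) * (1 + \<epsilon> * s)"
        using e0[OF s] by (intro mult_right_mono) (auto simp: \<kappa>_def)
      then have "v * (\<kappa> * (1 + \<epsilon> * s)) \<le> v * (C * (\<epsilon> * s))"
        using e0[OF s] v by (intro mult_left_mono) auto
      moreover have "V_drift \<mu> * (1 + \<epsilon> * s) \<le> 0"
        using V_drift_nonpos[of \<mu>] e0[OF s] by (simp add: mult_nonpos_nonneg)
      moreover have "\<epsilon> * v * xi_sq_drift \<mu> \<le> \<epsilon> * v * (- C * s)"
        using xi[OF True] \<epsilon> v unfolding s_def by (intro mult_left_mono) auto
      ultimately show ?thesis by (simp add: mult_ac)
    next
      case False
      have s\<eta>: "s \<le> \<eta>\<^sup>2" unfolding s_def using False by (intro power_mono) auto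
      have "c' * v \<le> c' * (\<eta>\<^sup>2 + ?d)" using s\<eta> c' by (intro mult_left_mono) (auto simp: v_def)
      also have "\<dots> = c" using d by (simp add: c'_def add_nonneg_eq_0_iff)
      finally have "V_drift \<mu> \<le> - (c' * v)" using c(2)[of \<mu>] False by simp
      then have 1: "V_drift \<mu> * (1 + \<epsilon> * s) \<le> - (c' * v) * (1 + \<epsilon> * s)"
        using e0[OF s] by (intro mult_right_mono) auto
      have "\<epsilon> * v * xi_sq_drift \<mu> \<le> \<epsilon> * v * (3 * (1 + \<eta>\<^sup>2) * M)"
        using G[of \<mu>] s\<eta> M \<epsilon> v
        by (intro mult_left_mono order_trans[OF G] mult_right_mono) (auto simp: s_def)
      also have "\<dots> \<le> c' / 2 * v"
      proof -
        have "\<epsilon> * (6 * (1 + \<eta>\<^sup>2) * M) \<le> c'"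
        proof -
          have "6 * (1 + \<eta>\<^sup>2) * M > 0" using M by (simp add: add_pos_nonneg)
          moreover have "\<epsilon> \<le> c' / (6 * (1 + \<eta>\<^sup>2) * M)" by (simp add: \<epsilon>_def)
          ultimately show ?thesis by (simp only: pos_le_divide_eq)
        qed
        then have "v * (\<epsilon> * (6 * (1 + \<eta>\<^sup>2) * M)) \<le> v * c'" using v by (intro mult_left_mono) auto
        moreover have "\<epsilon> * v * (3 * (1 + \<eta>\<^sup>2) * M) = v * (\<epsilon> * (6 * (1 + \<eta>\<^sup>2) * M)) / 2" by simp
        ultimately show ?thesis using mult.commute[of v c'] by linarith
      qed
      also have "\<dots> \<le> c' / 2 * v * (1 + \<epsilon> * s)"
        using mult_left_mono[of 1 "1 + \<epsilon> * s" "c' / 2 * v"] c' v \<epsilon> s by simp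
      finally have "V_drift \<mu> * (1 + \<epsilon> * s) + \<epsilon> * v * xi_sq_drift \<mu> \<le> - (c' / 2) * (v * (1 + \<epsilon> * s))"
        using 1 by (simp add: mult.assoc)
      also have "\<dots> \<le> - \<kappa> * (v * (1 + \<epsilon> * s))"
      proof -
        have "\<kappa> \<le> c' / 2" unfolding \<kappa>_def by (rule min.cobounded1)
        then show ?thesis using v e0[OF s] by (intro mult_right_mono) auto
      qed
      finally show ?thesis .
    qed
    then show "V_drift \<mu> * (1 + \<epsilon> * (norm \<mu>)\<^sup>2) + \<epsilon> * ((norm \<mu>)\<^sup>2 + real CARD('n)) * xi_sq_drift \<mu> \<le> - \<kappa> * lyap \<epsilon> \<mu> 1"
      unfolding lyap by (simp add: s_def v_def)
  qed (use \<epsilon> \<kappa> in auto)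
qed

end

section \<open>From one step to the law of the chain\<close>

lemma borel_measurable_spherical:
  fixes xs :: "real ^ 'n" and \<nu> :: "real \<Rightarrow> real"
  assumes "strict_mono \<nu>" shows "(\<lambda>x. \<nu> (norm (x - xs))) \<in> borel_measurable borel"
proof -
  have [measurable]: "\<nu> \<in> borel_measurable borel"
    by (rule borel_measurable_mono[OF strict_mono_mono[OF assms]])
  show ?thesis by measurable
qed

context selection_weights begin

lemma measurable_lyap [measurable]:
  "(\<lambda>\<theta>. lyap \<epsilon> (fst \<theta> - xs) (snd \<theta>)) \<in> borel_measurable (borel :: ((real ^ 'n) \<times> real) measure)"
  unfolding lyap_def by measurable

lemma step_affine:
  fixes m xs :: "real ^ 'n"
  assumes "strict_mono \<nu>" "f = (\<lambda>x. \<nu> (norm (x - xs)))" and \<sigma>: "\<sigma> > 0"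
  defines "\<mu> \<equiv> (m - xs) /\<^sub>R \<sigma>"
  shows "(m, \<sigma>) + \<alpha> *\<^sub>R increment f w lam (m, \<sigma>) (\<lambda>i. m + \<sigma> *\<^sub>R z i)
    = (xs + \<sigma> *\<^sub>R (\<mu> + \<alpha> *\<^sub>R mean_step w lam \<mu> z), \<sigma> * (1 + \<alpha> * size_step w lam \<mu> z))"
  unfolding increment_affine[OF assms(1-3)] using \<sigma>
  by (simp add: \<mu>_def scaleR_add_right algebra_simps)

lemma measurable_step [measurable]:
  fixes m xs :: "real ^ 'n"
  shows "(\<lambda>z. (xs + \<sigma> *\<^sub>R (\<mu> + \<alpha> *\<^sub>R mean_step w lam \<mu> z), \<sigma> * (1 + \<alpha> * size_step w lam \<mu> z)))
    \<in> borel_measurable (samples lam (0, 1))"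
  by (intro borel_measurable_Pair) measurable

lemma kernel_affine:
  fixes m xs :: "real ^ 'n"
  assumes nu: "strict_mono \<nu>" and f: "f = (\<lambda>x. \<nu> (norm (x - xs)))" and \<sigma>: "\<sigma> > 0"
  defines "\<mu> \<equiv> (m - xs) /\<^sub>R \<sigma>"
  shows "ssa_kernel f w lam \<alpha> (m, \<sigma>) = distr (samples lam (0, 1)) borel
    (\<lambda>z. (xs + \<sigma> *\<^sub>R (\<mu> + \<alpha> *\<^sub>R mean_step w lam \<mu> z), \<sigma> * (1 + \<alpha> * size_step w lam \<mu> z)))"
proof -
  have "f \<in> borel_measurable borel" unfolding f using nu by (rule borel_measurable_spherical)
  from ssa_kernel_eq[OF this less_imp_neq[OF \<sigma>, THEN not_sym], of w lam \<alpha> m] show ?thesis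
    unfolding step_affine[OF nu f \<sigma>] \<mu>_def .
qed

lemma size_factor_pos:
  assumes "0 < \<alpha>" "\<alpha> \<le> 1/2" shows "1 + \<alpha> * size_step w lam \<mu> (z :: nat \<Rightarrow> real ^ 'n) > 0"
proof -
  have "\<alpha> * size_step w lam \<mu> z \<ge> \<alpha> * (-1/2)" using assms size_step_ge by (intro mult_left_mono) auto
  then show ?thesis using assms by simp
qed

lemma kernel_prob_space_and_size_pos:
  fixes xs :: "real ^ 'n"
  assumes nu: "strict_mono \<nu>" and f: "f = (\<lambda>x. \<nu> (norm (x - xs)))" and \<theta>: "snd \<theta> > 0"
    and \<alpha>: "0 < \<alpha>" "\<alpha> \<le> 1/2"
  shows "prob_space (ssa_kernel f w lam \<alpha> \<theta>)" "AE \<theta>' in ssa_kernel f w lam \<alpha> \<theta>. snd \<theta>' > 0"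
proof -
  obtain m \<sigma> where [simp]: "\<theta> = (m, \<sigma>)" and \<sigma>: "\<sigma> > 0" using \<theta> by (cases \<theta>) auto
  interpret prob_space "samples lam (0 :: real ^ 'n, 1)" by (rule prob_space_samples) simp
  show "prob_space (ssa_kernel f w lam \<alpha> \<theta>)"
    unfolding \<open>\<theta> = _\<close> kernel_affine[OF nu f \<sigma>] by (rule prob_space_distr) measurable
  show "AE \<theta>' in ssa_kernel f w lam \<alpha> \<theta>. snd \<theta>' > 0"
    unfolding \<open>\<theta> = _\<close> kernel_affine[OF nu f \<sigma>]
    by (subst AE_distr_iff) (use \<sigma> size_factor_pos[OF \<alpha>] in \<open>auto simp: zero_less_mult_iff\<close>)
qed

text \<open>
The argument only carries the dimension.
\<close>

definition dominator_moment :: "'n::finite itself \<Rightarrow> real" where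
  "dominator_moment _ = (\<integral>z. dominator lam z ^ 7 \<partial>samples lam (0 :: real ^ 'n, 1))"

text \<open>
The expansion integrated over the samples: the first-order term is bounded by the drift condition,
the quadratic one by the seventh moment of \<open>T\<close>.
\<close>

lemma kernel_contraction:
  fixes xs :: "real ^ 'n"
  assumes nu: "strict_mono \<nu>" and f: "f = (\<lambda>x. \<nu> (norm (x - xs)))" and \<theta>: "snd \<theta> > 0"
    and \<alpha>: "0 < \<alpha>" "\<alpha> \<le> 1/2" and \<epsilon>: "0 < \<epsilon>" "\<epsilon> \<le> 1"
    and drift: "\<And>\<mu> :: real ^ 'n. V_drift \<mu> * (1 + \<epsilon> * (norm \<mu>)\<^sup>2)
        + \<epsilon> * ((norm \<mu>)\<^sup>2 + real CARD('n)) * xi_sq_drift \<mu> \<le> - \<kappa> * lyap \<epsilon> \<mu> 1"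
  shows "(\<integral>\<^sup>+\<theta>'. ennreal (lyap \<epsilon> (fst \<theta>' - xs) (snd \<theta>')) \<partial>ssa_kernel f w lam \<alpha> \<theta>)
    \<le> ennreal ((1 - \<kappa> * \<alpha> + 86 * \<alpha>\<^sup>2 * dominator_moment TYPE('n)) * lyap \<epsilon> (fst \<theta> - xs) (snd \<theta>))"
proof -
  obtain m \<sigma> where \<theta>_eq: "\<theta> = (m, \<sigma>)" and \<sigma>: "\<sigma> > 0" using \<theta> by (cases \<theta>) auto
  interpret prob_space "samples lam (0 :: real ^ 'n, 1)" by (rule prob_space_samples) simp
  define \<mu> where "\<mu> = (m - xs) /\<^sub>R \<sigma>"
  let ?Z = "samples lam (0 :: real ^ 'n, 1)"
  let ?L = "\<lambda>z. lyap \<epsilon> (\<mu> + \<alpha> *\<^sub>R mean_step w lam \<mu> z) (1 + \<alpha> * size_step w lam \<mu> z)"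
  let ?B = "lyap \<epsilon> \<mu> 1"
  let ?Q = "\<lambda>z. V_rate \<mu> z * (1 + \<epsilon> * (norm \<mu>)\<^sup>2) + \<epsilon> * ((norm \<mu>)\<^sup>2 + real CARD('n)) * xi_sq_rate \<mu> z"
  let ?R = "\<lambda>z. ?B + \<alpha> * ?Q z + 86 * \<alpha>\<^sup>2 * ?B * dominator lam z ^ 7"
  have L0: "?B \<ge> 0" using \<epsilon> by (intro lyap_nonneg) simp
  have L: "?L z \<le> ?R z" "?L z \<ge> 0" for z
    using lyap_step_le[OF \<alpha> \<epsilon>, of \<mu> z] \<epsilon> by (auto intro: lyap_nonneg)
  have R1: "has_bochner_integral ?Z ?Q
      (V_drift \<mu> * (1 + \<epsilon> * (norm \<mu>)\<^sup>2) + \<epsilon> * ((norm \<mu>)\<^sup>2 + real CARD('n)) * xi_sq_drift \<mu>)"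
    unfolding V_drift_def xi_sq_drift_def
    by (intro has_bochner_integral_add has_bochner_integral_mult_left has_bochner_integral_mult_right
        has_bochner_integral_integrable integrable_V_rate integrable_xi_sq_rate)
  have R: "has_bochner_integral ?Z ?R (?B + \<alpha> * (V_drift \<mu> * (1 + \<epsilon> * (norm \<mu>)\<^sup>2)
      + \<epsilon> * ((norm \<mu>)\<^sup>2 + real CARD('n)) * xi_sq_drift \<mu>) + 86 * \<alpha>\<^sup>2 * ?B * dominator_moment TYPE('n))"
    unfolding dominator_moment_def
    by (intro has_bochner_integral_add has_bochner_integral_mult_right R1
        has_bochner_integral_integrable integrable_dominator)
       (simp add: has_bochner_integral_iff prob_space)
  have scale: "lyap \<epsilon> (xs + \<sigma> *\<^sub>R y - xs) (\<sigma> * t) = \<sigma>\<^sup>2 * lyap \<epsilon> y t" for y t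
    using lyap_scale[OF \<sigma>, of \<epsilon> y t] by simp
  have "(\<integral>\<^sup>+\<theta>'. ennreal (lyap \<epsilon> (fst \<theta>' - xs) (snd \<theta>')) \<partial>ssa_kernel f w lam \<alpha> \<theta>)
      = (\<integral>\<^sup>+z. ennreal (\<sigma>\<^sup>2 * ?L z) \<partial>?Z)"
    unfolding \<theta>_eq kernel_affine[OF nu f \<sigma>, folded \<mu>_def]
    by (subst nn_integral_distr) (measurable, simp only: fst_conv snd_conv scale \<mu>_def)
  also have "\<dots> \<le> (\<integral>\<^sup>+z. ennreal (\<sigma>\<^sup>2 * ?R z) \<partial>?Z)"
    using L by (intro nn_integral_mono ennreal_leI mult_left_mono) auto
  also have "\<dots> = ennreal (\<integral>z. \<sigma>\<^sup>2 * ?R z \<partial>?Z)"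
    by (rule nn_integral_eq_integral)
      (use R L in \<open>auto simp: has_bochner_integral_iff intro!: integrable_mult_right mult_nonneg_nonneg AE_I2 intro: order_trans\<close>)
  also have "(\<integral>z. \<sigma>\<^sup>2 * ?R z \<partial>?Z) = \<sigma>\<^sup>2 * (?B + \<alpha> * (V_drift \<mu> * (1 + \<epsilon> * (norm \<mu>)\<^sup>2)
      + \<epsilon> * ((norm \<mu>)\<^sup>2 + real CARD('n)) * xi_sq_drift \<mu>) + 86 * \<alpha>\<^sup>2 * ?B * dominator_moment TYPE('n))"
    using R by (simp add: has_bochner_integral_iff)
  also have "\<dots> \<le> \<sigma>\<^sup>2 * (?B + \<alpha> * (- \<kappa> * ?B) + 86 * \<alpha>\<^sup>2 * ?B * dominator_moment TYPE('n))"
    using drift[of \<mu>] \<alpha> by (intro mult_left_mono add_right_mono add_left_mono) auto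
  also have "\<dots> = (1 - \<kappa> * \<alpha> + 86 * \<alpha>\<^sup>2 * dominator_moment TYPE('n)) * (\<sigma>\<^sup>2 * ?B)" by (simp add: algebra_simps)
  also have "\<sigma>\<^sup>2 * ?B = lyap \<epsilon> (fst \<theta> - xs) (snd \<theta>)"
    using lyap_scale[OF \<sigma>, of \<epsilon> \<mu> 1] \<sigma> by (simp add: \<mu>_def \<theta>_eq)
  finally show ?thesis by (simp add: ennreal_leI)
qed

text \<open>
The contraction holds for positive \<open>\<sigma>\<close> only, so it is iterated together with the fact that the law is
concentrated on such parameters.
\<close>

lemma ssa_law_lyap_decay:
  fixes xs :: "real ^ 'n" and \<theta>\<^sub>0 :: "(real ^ 'n) \<times> real"
  assumes nu: "strict_mono \<nu>" and f: "f = (\<lambda>x. \<nu> (norm (x - xs)))" and \<theta>: "snd \<theta>\<^sub>0 > 0"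
    and \<alpha>: "0 < \<alpha>" "\<alpha> \<le> 1/2" and \<epsilon>: "0 \<le> \<epsilon>" and \<rho>: "\<rho> \<ge> 0"
    and contr: "\<And>\<theta>. snd \<theta> > 0 \<Longrightarrow>
      (\<integral>\<^sup>+\<theta>'. ennreal (lyap \<epsilon> (fst \<theta>' - xs) (snd \<theta>')) \<partial>ssa_kernel f w lam \<alpha> \<theta>)
        \<le> ennreal (\<rho> * lyap \<epsilon> (fst \<theta> - xs) (snd \<theta>))"
  shows "sets (ssa_law f w lam \<alpha> \<theta>\<^sub>0 n) = sets borel \<and> prob_space (ssa_law f w lam \<alpha> \<theta>\<^sub>0 n)
    \<and> (AE \<theta> in ssa_law f w lam \<alpha> \<theta>\<^sub>0 n. snd \<theta> > 0)
    \<and> (\<integral>\<^sup>+\<theta>. ennreal (lyap \<epsilon> (fst \<theta> - xs) (snd \<theta>)) \<partial>ssa_law f w lam \<alpha> \<theta>\<^sub>0 n)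
       \<le> ennreal (\<rho> ^ n * lyap \<epsilon> (fst \<theta>\<^sub>0 - xs) (snd \<theta>\<^sub>0))"
proof (induction n)
  case 0
  have "AE \<theta> in return borel \<theta>\<^sub>0. snd \<theta> > 0" using \<theta> by (subst AE_return) auto
  then show ?case unfolding ssa_law.simps by (simp add: nn_integral_return prob_space_return)
next
  case (Suc n)
  let ?M = "ssa_law f w lam \<alpha> \<theta>\<^sub>0 n" and ?K = "ssa_kernel f w lam \<alpha>"
  let ?L = "\<lambda>\<theta>. lyap \<epsilon> (fst \<theta> - xs) (snd \<theta>)"
  have sets: "sets ?M = sets borel" and prob: "prob_space ?M" and AE: "AE \<theta> in ?M. snd \<theta> > 0"
    and le: "(\<integral>\<^sup>+\<theta>. ennreal (?L \<theta>) \<partial>?M) \<le> ennreal (\<rho> ^ n * ?L \<theta>\<^sub>0)"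
    using Suc by auto
  interpret prob_space ?M by (rule prob)
  have "f \<in> borel_measurable borel" unfolding f using nu by (rule borel_measurable_spherical)
  then have "?K \<in> measurable borel (subprob_algebra borel)" using lam by (intro measurable_ssa_kernel) auto
  then have K: "?K \<in> measurable ?M (subprob_algebra borel)" using sets by (simp cong: measurable_cong_sets)
  have 1: "sets (?M \<bind> ?K) = sets borel"
    by (rule sets_bind) (auto simp: ssa_kernel_def not_empty)
  have 2: "prob_space (?M \<bind> ?K)"
    using AE kernel_prob_space_and_size_pos(1)[OF nu f _ \<alpha>] by (intro prob_space_bind[OF _ K]) auto
  have 3: "AE \<theta> in ?M \<bind> ?K. snd \<theta> > 0"
    using AE kernel_prob_space_and_size_pos(2)[OF nu f _ \<alpha>] by (subst AE_bind[OF K]) auto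
  have "(\<integral>\<^sup>+\<theta>. ennreal (?L \<theta>) \<partial>(?M \<bind> ?K)) = (\<integral>\<^sup>+\<theta>. \<integral>\<^sup>+\<theta>'. ennreal (?L \<theta>') \<partial>?K \<theta> \<partial>?M)"
    by (rule nn_integral_bind[OF _ K]) measurable
  also have "\<dots> \<le> (\<integral>\<^sup>+\<theta>. ennreal \<rho> * ennreal (?L \<theta>) \<partial>?M)"
    using AE contr by (intro nn_integral_mono_AE) (auto simp: ennreal_mult' \<rho>)
  also have "\<dots> = ennreal \<rho> * (\<integral>\<^sup>+\<theta>. ennreal (?L \<theta>) \<partial>?M)"
    using sets by (intro nn_integral_cmult) (simp cong: measurable_cong_sets)
  also have "\<dots> \<le> ennreal \<rho> * ennreal (\<rho> ^ n * ?L \<theta>\<^sub>0)" by (intro mult_left_mono le) auto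
  also have "\<dots> = ennreal (\<rho> ^ Suc n * ?L \<theta>\<^sub>0)"
    using \<rho> lyap_nonneg[OF \<epsilon>] by (simp add: ennreal_mult' mult.assoc)
  finally show ?case using 1 2 3 unfolding ssa_law.simps by simp
qed

end

lemma gauss_norm_square:
  fixes xs :: "real ^ 'n"
  assumes "snd \<theta> > 0"
  shows "(\<integral>\<^sup>+x. ennreal ((norm (x - xs))\<^sup>2) \<partial>gauss \<theta>) = ennreal (V xs \<theta>)"
proof -
  obtain m \<sigma> where \<theta>: "\<theta> = (m, \<sigma>)" and \<sigma>: "\<sigma> > 0" using assms by (cases \<theta>) auto
  define \<mu> where "\<mu> = (m - xs) /\<^sub>R \<sigma>"
  have nrm: "(norm (m + \<sigma> *\<^sub>R z - xs))\<^sup>2 = \<sigma>\<^sup>2 * (norm (\<mu> + z))\<^sup>2" for z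
  proof -
    have "m + \<sigma> *\<^sub>R z - xs = \<sigma> *\<^sub>R (\<mu> + z)" using \<sigma> by (simp add: scaleR_add_right \<mu>_def)
    then show ?thesis by (simp add: power_mult_distrib)
  qed
  have "(\<integral>\<^sup>+x. ennreal ((norm (x - xs))\<^sup>2) \<partial>gauss \<theta>) = (\<integral>\<^sup>+z. ennreal (\<sigma>\<^sup>2) * ennreal ((norm (\<mu> + z))\<^sup>2) \<partial>gauss (0, 1))"
    unfolding \<theta> using \<sigma> by (subst gauss_affine) (simp_all add: nn_integral_distr nrm ennreal_mult'')
  also have "\<dots> = ennreal (\<sigma>\<^sup>2 * ((norm \<mu>)\<^sup>2 + real CARD('n)))"
    by (subst nn_integral_cmult) (simp_all add: nn_integral_std_gauss_norm_square ennreal_mult'')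
  also have "\<sigma>\<^sup>2 * ((norm \<mu>)\<^sup>2 + real CARD('n)) = V xs \<theta>"
  proof -
    have "norm (m - xs) = \<sigma> * norm \<mu>" using \<sigma> by (simp add: \<mu>_def)
    then show ?thesis by (simp add: V_def \<theta> power_mult_distrib distrib_left)
  qed
  finally show ?thesis .
qed

text \<open>
Makes the expected distance to the optimum positive. Since \<open>ln 0 = 0\<close>, a vanishing expectation would
not produce a negative rate.
\<close>

lemma AE_gauss_neq:
  assumes "snd \<theta> > 0" shows "AE x in gauss \<theta>. x \<noteq> (xs :: real ^ 'n)"
proof (rule AE_not_in[THEN AE_mp])
  show "{xs} \<in> null_sets (gauss \<theta>)"
    using emeasure_gauss_eq_0_iff[OF assms, of "{xs}"] by (simp add: null_sets_def)
qed auto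

text \<open>
The passage from a geometric bound on second moments to a rate for first moments.
\<close>

lemma limsup_log_expectation_neg:
  fixes g :: "'a \<Rightarrow> real" and M :: "nat \<Rightarrow> 'a measure"
  assumes prob: "\<And>n. prob_space (M n)" and meas: "\<And>n. g \<in> borel_measurable (M n)"
    and pos: "\<And>n. AE x in M n. g x > 0"
    and K: "K > 0" and \<rho>: "0 < \<rho>" "\<rho> < 1"
    and sq: "\<And>n. (\<integral>\<^sup>+x. ennreal ((g x)\<^sup>2) \<partial>M n) \<le> ennreal (\<rho> ^ n * K)"
  shows "limsup (\<lambda>n. ereal (1 / real n * ln (\<integral>x. g x \<partial>M n))) < 0"
proof -
  have I: "0 < (\<integral>x. g x \<partial>M n)" "(\<integral>x. g x \<partial>M n) \<le> sqrt (\<rho> ^ n * K)" for n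
  proof -
    interpret prob_space "M n" by (rule prob)
    note [measurable] = meas[of n]
    have int2: "integrable (M n) (\<lambda>x. (g x)\<^sup>2)"
      using sq[of n] by (auto simp: integrable_iff_bounded intro: le_less_trans)
    have int: "integrable (M n) g"
    proof (rule Bochner_Integration.integrable_bound)
      show "integrable (M n) (\<lambda>x. 1 + (g x)\<^sup>2)" using int2 by simp
      have "\<bar>y\<bar> \<le> 1 + y\<^sup>2" for y :: real using sum_squares_bound[of "\<bar>y\<bar>" 1] by simp
      then show "AE x in M n. norm (g x) \<le> norm (1 + (g x)\<^sup>2)" by (auto simp: abs_of_nonneg)
    qed simp
    have sq': "(\<integral>x. (g x)\<^sup>2 \<partial>M n) \<le> \<rho> ^ n * K"
      using sq[of n] K \<rho> by (simp add: nn_integral_eq_integral[OF int2])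
    \<comment> \<open>Integrating \<open>g \<le> t / 2 + g\<^sup>2 / (2 t)\<close> with this \<open>t\<close>, which balances the two terms, gives \<open>E g \<le> t\<close>.\<close>
    define t where "t = sqrt (\<rho> ^ n * K)"
    have t: "t > 0" "t\<^sup>2 = \<rho> ^ n * K" using K \<rho> by (auto simp: t_def)
    have "(\<integral>x. g x \<partial>M n) \<le> (\<integral>x. t / 2 + (g x)\<^sup>2 / (2 * t) \<partial>M n)"
    proof (intro integral_mono int)
      show "integrable (M n) (\<lambda>x. t / 2 + (g x)\<^sup>2 / (2 * t))" using int2 by simp
      show "g x \<le> t / 2 + (g x)\<^sup>2 / (2 * t)" for x
        using sum_squares_bound[of "g x" t] t by (simp add: field_simps power2_eq_square)
    qed
    also have "\<dots> = t / 2 + (\<integral>x. (g x)\<^sup>2 \<partial>M n) / (2 * t)"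
      using int2 by (simp add: prob_space)
    also have "\<dots> \<le> t / 2 + t\<^sup>2 / (2 * t)" using sq' t by (intro add_left_mono divide_right_mono) auto
    also have "\<dots> = t" using t(1) by (simp add: power2_eq_square)
    finally show "(\<integral>x. g x \<partial>M n) \<le> sqrt (\<rho> ^ n * K)" by (simp add: t_def)
    have nn: "AE x in M n. 0 \<le> g x" using pos[of n] by auto
    have "(\<integral>x. g x \<partial>M n) \<noteq> 0"
    proof
      assume "(\<integral>x. g x \<partial>M n) = 0"
      then have "AE x in M n. g x = 0" using integral_nonneg_eq_0_iff_AE[OF int nn] by simp
      with pos[of n] have "AE x in M n. False" by eventually_elim simp
      then show False by simp
    qed
    then show "0 < (\<integral>x. g x \<partial>M n)" using integral_nonneg_AE[OF nn] by linarith
  qed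
  let ?b = "\<lambda>n. ln K / 2 * (1 / real n) + ln \<rho> / 2"
  have "1 / real n * ln (\<integral>x. g x \<partial>M n) \<le> ?b n" if "n \<ge> 1" for n
  proof -
    have "ln (\<integral>x. g x \<partial>M n) \<le> ln (sqrt (\<rho> ^ n * K))" using I[of n] by (intro ln_mono) auto
    also have "\<dots> = (real n * ln \<rho> + ln K) / 2" using K \<rho> by (simp add: ln_sqrt ln_mult ln_realpow)
    finally have "1 / real n * ln (\<integral>x. g x \<partial>M n) \<le> 1 / real n * ((real n * ln \<rho> + ln K) / 2)"
      by (intro mult_left_mono) auto
    also have "\<dots> = ?b n" using that by (simp add: field_simps)
    finally show ?thesis .
  qed
  then have "limsup (\<lambda>n. ereal (1 / real n * ln (\<integral>x. g x \<partial>M n))) \<le> limsup (\<lambda>n. ereal (?b n))"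
    by (intro Limsup_mono eventually_sequentiallyI[of 1]) simp
  also have "(\<lambda>n. ereal (?b n)) \<longlonglongrightarrow> ereal (ln K / 2 * 0 + ln \<rho> / 2)"
    by (intro tendsto_intros lim_1_over_n)
  then have "limsup (\<lambda>n. ereal (?b n)) = ereal (ln \<rho> / 2)"
    by (simp add: lim_imp_Limsup)
  also have "\<dots> < 0" using \<rho> by simp
  finally show ?thesis .
qed

section \<open>Geometric convergence\<close>

text \<open>
Away from \<open>m = x\<^sup>*\<close> the gradient exists, and the description operator picks it because gradients are
unique.
\<close>

lemma gradient_xi:
  fixes xs \<mu> :: "real ^ 'n"
  assumes "\<mu> \<noteq> 0"
  shows "gradient (xi xs) (xs + \<mu>, 1) = (sgn \<mu>, - norm \<mu>)"
proof -
  have "(xi xs has_derivative (\<lambda>h. h \<bullet> (sgn \<mu>, - norm \<mu>))) (at (xs + \<mu>, 1))"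
  proof -
    have "((\<lambda>\<theta>. fst \<theta> - xs) has_derivative fst) (at (xs + \<mu>, 1 :: real))"
      by (auto intro!: derivative_eq_intros)
    moreover have "(norm has_derivative (\<lambda>h. h \<bullet> sgn \<mu>)) (at (fst (xs + \<mu>, 1 :: real) - xs))"
      using GDERIV_norm[OF assms] by (simp add: gderiv_def)
    ultimately have "((\<lambda>\<theta>. norm (fst \<theta> - xs)) has_derivative (\<lambda>h. fst h \<bullet> sgn \<mu>)) (at (xs + \<mu>, 1 :: real))"
      by (rule has_derivative_compose)
    then show ?thesis unfolding xi_def[abs_def]
      by (auto intro!: derivative_eq_intros simp: inner_prod_def)
  qed
  then have D: "GDERIV (xi xs) (xs + \<mu>, 1) :> (sgn \<mu>, - norm \<mu>)" by (simp add: gderiv_def)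
  have "E = (sgn \<mu>, - norm \<mu>)" if "GDERIV (xi xs) (xs + \<mu>, 1) :> E" for E
  proof -
    have "(\<lambda>h. h \<bullet> E) = (\<lambda>h. h \<bullet> (sgn \<mu>, - norm \<mu>))"
      using that D unfolding gderiv_def by (rule has_derivative_unique)
    then have "(E - (sgn \<mu>, - norm \<mu>)) \<bullet> (E - (sgn \<mu>, - norm \<mu>)) = 0"
      by (metis inner_diff_right right_minus_eq)
    then show ?thesis by simp
  qed
  with D show ?thesis unfolding gradient_def by (blast intro: the_equality)
qed

lemma integral_Pair:
  fixes g :: "'a \<Rightarrow> 'b::{banach, second_countable_topology}" and h :: "'a \<Rightarrow> 'c::{banach, second_countable_topology}"
  assumes "integrable M g" "integrable M h"
  shows "(\<integral>x. (g x, h x) \<partial>M) = (\<integral>x. g x \<partial>M, \<integral>x. h x \<partial>M)"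
proof -
  have bl: "bounded_linear (\<lambda>x::'b. (x, 0::'c))" "bounded_linear (\<lambda>y::'c. (0::'b, y))"
    by (auto intro: bounded_linear_Pair bounded_linear_ident bounded_linear_zero)
  have "(\<integral>x. (g x, h x) \<partial>M) = (\<integral>x. (g x, 0) + (0, h x) \<partial>M)" by simp
  also have "\<dots> = (\<integral>x. (g x, 0) \<partial>M) + (\<integral>x. (0, h x) \<partial>M)"
    using integrable_bounded_linear[OF bl(1) assms(1)] integrable_bounded_linear[OF bl(2) assms(2)]
    by (rule Bochner_Integration.integral_add)
  finally show ?thesis
    using integral_bounded_linear[OF bl(1) assms(1)] integral_bounded_linear[OF bl(2) assms(2)] by simp
qed

context selection_weights begin

lemma mean_field_unit:
  fixes xs \<mu> :: "real ^ 'n"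
  assumes nu: "strict_mono \<nu>" and f: "f = (\<lambda>x. \<nu> (norm (x - xs)))"
  shows "mean_field f w lam (xs + \<mu>, 1) =
    (\<integral>z. mean_step w lam \<mu> z \<partial>samples lam (0, 1), \<integral>z. size_step w lam \<mu> z \<partial>samples lam (0, 1))"
proof -
  have [measurable]: "f \<in> borel_measurable borel" unfolding f using nu by (rule borel_measurable_spherical)
  have inc: "increment f w lam (xs + \<mu>, 1) \<in> borel_measurable (\<Pi>\<^sub>M i\<in>{1..lam}. borel)"
    by (rule measurable_increment) auto
  have "mean_field f w lam (xs + \<mu>, 1)
      = (\<integral>z. increment f w lam (xs + \<mu>, 1) (compose {1..lam} (\<lambda>z. (xs + \<mu>) + 1 *\<^sub>R z) z) \<partial>samples lam (0, 1))"
    unfolding mean_field_def by (subst samples_affine, simp, subst integral_distr[OF measurable_affine_compose inc]) simp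
  also have "\<dots> = (\<integral>z. (mean_step w lam \<mu> z, size_step w lam \<mu> z) \<partial>samples lam (0, 1))"
  proof (intro Bochner_Integration.integral_cong refl)
    fix z :: "nat \<Rightarrow> real ^ 'n"
    have "increment f w lam (xs + \<mu>, 1) (compose {1..lam} (\<lambda>z. (xs + \<mu>) + 1 *\<^sub>R z) z)
        = increment f w lam (xs + \<mu>, 1) (\<lambda>i. (xs + \<mu>) + 1 *\<^sub>R z i)"
      by (rule increment_cong) (simp add: compose_def)
    also have "\<dots> = (mean_step w lam \<mu> z, size_step w lam \<mu> z)"
      using increment_affine[OF nu f, of 1 w lam "xs + \<mu>" z] by simp
    finally show "increment f w lam (xs + \<mu>, 1) (compose {1..lam} (\<lambda>z. (xs + \<mu>) + 1 *\<^sub>R z) z)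
        = (mean_step w lam \<mu> z, size_step w lam \<mu> z)" .
  qed
  also have "\<dots> = (\<integral>z. mean_step w lam \<mu> z \<partial>samples lam (0, 1), \<integral>z. size_step w lam \<mu> z \<partial>samples lam (0, 1))"
    by (rule integral_Pair[OF integrable_mean_step integrable_size_step])
  finally show ?thesis .
qed

text \<open>
The drift assumed for \<open>\<xi>\<close>, evaluated at \<open>\<sigma> = 1\<close> and multiplied by \<open>2 \<parallel>\<mu>\<parallel>\<close>, since \<open>\<nabla> \<xi>\<^sup>2 = 2 \<xi> \<nabla> \<xi>\<close>.
\<close>

lemma xi_sq_drift_le:
  fixes xs \<mu> :: "real ^ 'n"
  assumes nu: "strict_mono \<nu>" and f: "f = (\<lambda>x. \<nu> (norm (x - xs)))"
    and \<eta>: "\<eta> > 0"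
      "\<forall>\<theta>\<in>param_space. xi xs \<theta> \<ge> \<eta> \<longrightarrow>
         gradient (xi xs) \<theta> \<bullet> mean_field f w lam \<theta> < - (C / (2 * real CARD('n))) * xi xs \<theta>"
    and \<mu>: "norm \<mu> \<ge> \<eta>"
  shows "xi_sq_drift \<mu> \<le> - (C / real CARD('n)) * (norm \<mu>)\<^sup>2"
proof -
  let ?a = "\<integral>z. mean_step w lam \<mu> z \<partial>samples lam (0, 1)" and ?b = "\<integral>z. size_step w lam \<mu> z \<partial>samples lam (0, 1)"
  have n: "norm \<mu> > 0" using \<mu> \<eta>(1) by linarith
  have "(xs + \<mu>, 1) \<in> param_space" by (simp add: param_space_def)
  moreover have xi: "xi xs (xs + \<mu>, 1) = norm \<mu>" by (simp add: xi_def)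
  ultimately have "gradient (xi xs) (xs + \<mu>, 1) \<bullet> mean_field f w lam (xs + \<mu>, 1) < - (C / (2 * real CARD('n))) * norm \<mu>"
    using \<eta>(2) \<mu> by metis
  then have "sgn \<mu> \<bullet> ?a - norm \<mu> * ?b < - (C / (2 * real CARD('n))) * norm \<mu>"
    using n by (simp add: gradient_xi mean_field_unit[OF nu f])
  then have "2 * norm \<mu> * (sgn \<mu> \<bullet> ?a - norm \<mu> * ?b) \<le> 2 * norm \<mu> * (- (C / (2 * real CARD('n))) * norm \<mu>)"
    using n by (intro mult_left_mono) auto
  also have "2 * norm \<mu> * (sgn \<mu> \<bullet> ?a - norm \<mu> * ?b) = xi_sq_drift \<mu>"
    using n by (simp add: xi_sq_drift_eq sgn_div_norm power2_eq_square field_simps)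
  finally show ?thesis by (simp add: power2_eq_square field_simps)
qed

end

theorem theorem16:
  fixes lam :: nat and w :: "nat \<Rightarrow> real" and xs :: "real ^ 'n"
    and \<nu> :: "real \<Rightarrow> real" and f :: "real ^ 'n \<Rightarrow> real"
    and C\<^sub>\<sigma> \<eta> :: real
  assumes lam: "lam \<ge> 2"
    and nu: "strict_mono \<nu>"
    and f: "f = (\<lambda>x. \<nu> (norm (x - xs)))"
    and W1: "\<forall>i\<in>{1..lam}. w i \<ge> 0" "(\<Sum>i = 1..lam. w i) = 1"
    and W2: "\<forall>i\<in>{1..<lam}. w i \<ge> w (i + 1)" "\<exists>i\<in>{1..<lam}. w i > w (i + 1)"
    and W3: "C_sigma_bar w lam > 0"
    and C_sigma: "0 < C\<^sub>\<sigma>" "C\<^sub>\<sigma> < C_sigma_bar w lam"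
    and eta: "\<eta> > 0"
      "\<forall>\<theta>\<in>param_space. xi xs \<theta> \<ge> \<eta> \<longrightarrow>
         gradient (xi xs) \<theta> \<bullet> mean_field f w lam \<theta> < - (C\<^sub>\<sigma> / (2 * real CARD('n))) * xi xs \<theta>"
  shows "\<exists>\<alpha>\<^sub>0. 0 < \<alpha>\<^sub>0 \<and> \<alpha>\<^sub>0 < 2 \<and>
    (\<forall>\<theta>\<^sub>0\<in>param_space. \<forall>\<alpha>\<in>{0<..\<alpha>\<^sub>0}.
       limsup (\<lambda>n. ereal (1 / real n *
         ln (\<integral>\<theta>. Psi xs \<eta> \<theta> \<partial>ssa_law f w lam \<alpha> \<theta>\<^sub>0 n))) < 0 \<and>
       limsup (\<lambda>n. ereal (1 / real n *
         ln (\<integral>x. norm (x - xs) \<partial>ssa_sample_law f w lam \<alpha> \<theta>\<^sub>0 n))) < 0)"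
proof -
  interpret selection_weights lam w by unfold_locales (fact lam W1 W2)+
  have "C\<^sub>\<sigma> / real CARD('n) > 0" using C_sigma by simp
  from first_order_drift[OF eta(1) this xi_sq_drift_le[OF nu f eta]]
  obtain \<epsilon> \<kappa> where \<epsilon>: "0 < \<epsilon>" "\<epsilon> \<le> 1" and \<kappa>: "0 < \<kappa>"
    and drift: "\<And>\<mu> :: real ^ 'n. V_drift \<mu> * (1 + \<epsilon> * (norm \<mu>)\<^sup>2)
        + \<epsilon> * ((norm \<mu>)\<^sup>2 + real CARD('n)) * xi_sq_drift \<mu> \<le> - \<kappa> * lyap \<epsilon> \<mu> 1"
    by blast
  define B where "B = max 1 (dominator_moment TYPE('n))"
  \<comment> \<open>The bound \<open>1 / \<kappa>\<close> keeps \<open>\<rho>\<close> positive; \<open>\<kappa> / (172 B)\<close> makes the quadratic term at most half the linear one.\<close>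
  define \<alpha>\<^sub>0 where "\<alpha>\<^sub>0 = min (1/2) (min (1 / \<kappa>) (\<kappa> / (172 * B)))"
  have B: "B \<ge> 1" "dominator_moment TYPE('n) \<le> B" by (auto simp: B_def)
  have \<alpha>\<^sub>0: "0 < \<alpha>\<^sub>0" "\<alpha>\<^sub>0 < 2" using \<kappa> B by (auto simp: \<alpha>\<^sub>0_def)
  show ?thesis
  proof (intro exI conjI ballI)
    fix \<theta>\<^sub>0 :: "(real ^ 'n) \<times> real" and \<alpha> :: real
    assume \<theta>\<^sub>0: "\<theta>\<^sub>0 \<in> param_space" and "\<alpha> \<in> {0<..\<alpha>\<^sub>0}"
    then have \<alpha>: "0 < \<alpha>" "\<alpha> \<le> 1/2" "\<alpha> \<le> 1 / \<kappa>" "\<alpha> \<le> \<kappa> / (172 * B)" by (auto simp: \<alpha>\<^sub>0_def)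
    have \<theta>0: "snd \<theta>\<^sub>0 > 0" using \<theta>\<^sub>0 by (auto simp: param_space_def)
    define \<rho> where "\<rho> = 1 - \<kappa> * \<alpha> / 2"
    have "\<kappa> * \<alpha> \<le> 1" using \<alpha>(3) \<kappa> by (simp add: field_simps)
    then have \<rho>: "0 < \<rho>" "\<rho> < 1" using \<kappa> \<alpha> by (auto simp: \<rho>_def)
    have rate: "1 - \<kappa> * \<alpha> + 86 * \<alpha>\<^sup>2 * dominator_moment TYPE('n) \<le> \<rho>"
    proof -
      have "86 * \<alpha>\<^sup>2 * dominator_moment TYPE('n) \<le> 86 * \<alpha>\<^sup>2 * B" using B by (intro mult_left_mono) auto
      also have "\<dots> = \<alpha> * (\<alpha> * (172 * B)) / 2" by (simp add: power2_eq_square)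
      also have "\<dots> \<le> \<alpha> * \<kappa> / 2"
      proof -
        have "\<alpha> * (172 * B) \<le> \<kappa>" using \<alpha>(4) B by (simp add: pos_le_divide_eq)
        then show ?thesis using \<alpha>(1) by (intro divide_right_mono mult_left_mono) auto
      qed
      finally show ?thesis by (simp add: \<rho>_def mult.commute)
    qed
    let ?L = "\<lambda>\<theta>. lyap \<epsilon> (fst \<theta> - xs) (snd \<theta>)" and ?M = "ssa_law f w lam \<alpha> \<theta>\<^sub>0"
    have contr: "(\<integral>\<^sup>+\<theta>'. ennreal (?L \<theta>') \<partial>ssa_kernel f w lam \<alpha> \<theta>) \<le> ennreal (\<rho> * ?L \<theta>)"
      if "snd \<theta> > 0" for \<theta>
      by (rule order_trans[OF kernel_contraction[OF nu f that \<alpha>(1,2) \<epsilon> drift]])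
        (intro ennreal_leI mult_right_mono lyap_nonneg rate less_imp_le[OF \<epsilon>(1)])
    note law = ssa_law_lyap_decay[OF nu f \<theta>0 \<alpha>(1,2) less_imp_le[OF \<epsilon>(1)] less_imp_le[OF \<rho>(1)] contr]
    have sets: "sets (?M n) = sets borel" and prob: "prob_space (?M n)" and pos: "AE \<theta> in ?M n. snd \<theta> > 0"
      and le: "(\<integral>\<^sup>+\<theta>. ennreal (?L \<theta>) \<partial>?M n) \<le> ennreal (\<rho> ^ n * ?L \<theta>\<^sub>0)" for n
      using law[of n] by auto
    have V_pos: "V xs \<theta> > 0" if "snd \<theta> > 0" for \<theta> :: "(real ^ 'n) \<times> real"
      using that by (simp add: V_def add_nonneg_pos)
    have L_eq: "?L \<theta> = V xs \<theta> * (1 + \<epsilon> * (xi xs \<theta>)\<^sup>2)" for \<theta>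
      by (simp add: lyap_def V_def xi_def power_divide)
    have V_le: "V xs \<theta> \<le> ?L \<theta>" if "snd \<theta> > 0" for \<theta>
      using V_pos[OF that] \<epsilon> by (simp add: L_eq)
    have L0: "?L \<theta>\<^sub>0 > 0" using V_pos[OF \<theta>0] V_le[OF \<theta>0] by linarith
    have meas: "Psi xs \<eta> \<in> borel_measurable borel"
      unfolding Psi_def[abs_def] V_def[abs_def] xi_def[abs_def] by measurable
    define K where "K = \<eta> + 1 / \<epsilon>"
    have K: "K > 0" using eta(1) \<epsilon> by (simp add: K_def add_pos_pos)
    have Psi_sq: "(Psi xs \<eta> \<theta>)\<^sup>2 \<le> K * ?L \<theta>" if "snd \<theta> > 0" for \<theta>
    proof -
      have x: "xi xs \<theta> \<ge> 0" using that by (simp add: xi_def)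
      have "xi xs \<theta> \<le> 1 + (xi xs \<theta>)\<^sup>2" using sum_squares_bound[of "xi xs \<theta>" 1] x by simp
      also have "\<dots> \<le> (1 + \<epsilon> * (xi xs \<theta>)\<^sup>2) / \<epsilon>" using \<epsilon> by (simp add: field_simps)
      finally have "xi xs \<theta> \<le> 1 / \<epsilon> * (1 + \<epsilon> * (xi xs \<theta>)\<^sup>2)" by simp
      moreover have "\<eta> * 1 \<le> \<eta> * (1 + \<epsilon> * (xi xs \<theta>)\<^sup>2)" using eta(1) \<epsilon> by (intro mult_left_mono) auto
      ultimately have "max \<eta> (xi xs \<theta>) \<le> K * (1 + \<epsilon> * (xi xs \<theta>)\<^sup>2)"
        using x eta(1) unfolding K_def distrib_right by linarith
      then have "V xs \<theta> * max \<eta> (xi xs \<theta>) \<le> V xs \<theta> * (K * (1 + \<epsilon> * (xi xs \<theta>)\<^sup>2))"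
        using V_pos[OF that] by (intro mult_left_mono) auto
      moreover have "(Psi xs \<eta> \<theta>)\<^sup>2 = V xs \<theta> * max \<eta> (xi xs \<theta>)"
        using V_pos[OF that] eta(1) by (simp add: Psi_def power_mult_distrib le_max_iff_disj)
      ultimately show ?thesis by (simp add: L_eq mult_ac)
    qed
    show "limsup (\<lambda>n. ereal (1 / real n * ln (\<integral>\<theta>. Psi xs \<eta> \<theta> \<partial>?M n))) < 0"
    proof (rule limsup_log_expectation_neg[OF prob])
      show "Psi xs \<eta> \<in> borel_measurable (?M n)" for n
        using meas sets by (simp cong: measurable_cong_sets)
      show "AE \<theta> in ?M n. Psi xs \<eta> \<theta> > 0" for n
        using pos[of n]
      proof eventually_elim
        case (elim \<theta>)
        then show ?case using V_pos[OF elim] eta(1) by (auto simp: Psi_def less_max_iff_disj)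
      qed
      show "(\<integral>\<^sup>+\<theta>. ennreal ((Psi xs \<eta> \<theta>)\<^sup>2) \<partial>?M n) \<le> ennreal (\<rho> ^ n * (K * ?L \<theta>\<^sub>0))" for n
      proof -
        have "(\<integral>\<^sup>+\<theta>. ennreal ((Psi xs \<eta> \<theta>)\<^sup>2) \<partial>?M n) \<le> (\<integral>\<^sup>+\<theta>. ennreal K * ennreal (?L \<theta>) \<partial>?M n)"
          using pos[of n] Psi_sq K
          by (intro nn_integral_mono_AE) (auto simp: ennreal_mult'[symmetric] intro!: ennreal_leI)
        also have "\<dots> = ennreal K * (\<integral>\<^sup>+\<theta>. ennreal (?L \<theta>) \<partial>?M n)"
          using sets by (intro nn_integral_cmult) (simp cong: measurable_cong_sets)
        also have "\<dots> \<le> ennreal K * ennreal (\<rho> ^ n * ?L \<theta>\<^sub>0)" by (intro mult_left_mono le) auto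
        also have "\<dots> = ennreal (\<rho> ^ n * (K * ?L \<theta>\<^sub>0))"
          using K by (subst ennreal_mult'[symmetric]) (auto simp: mult_ac)
        finally show ?thesis .
      qed
    qed (use K L0 \<rho> in auto)
    have gk: "gauss \<in> measurable (?M n) (subprob_algebra borel)" for n
      using measurable_gauss_kernel sets by (simp cong: measurable_cong_sets)
    have sets': "sets (ssa_sample_law f w lam \<alpha> \<theta>\<^sub>0 n) = sets borel" for n
      unfolding ssa_sample_law_def
      by (rule sets_bind) (use prob_space.not_empty[OF prob] in auto)
    show "limsup (\<lambda>n. ereal (1 / real n * ln (\<integral>x. norm (x - xs) \<partial>ssa_sample_law f w lam \<alpha> \<theta>\<^sub>0 n))) < 0"
    proof (rule limsup_log_expectation_neg)
      show "prob_space (ssa_sample_law f w lam \<alpha> \<theta>\<^sub>0 n)" for n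
        unfolding ssa_sample_law_def
        by (rule prob_space.prob_space_bind[OF prob _ gk]) (use pos[of n] in \<open>auto intro: prob_space_gauss\<close>)
      show "(\<lambda>x. norm (x - xs)) \<in> borel_measurable (ssa_sample_law f w lam \<alpha> \<theta>\<^sub>0 n)" for n
        using sets' by (simp cong: measurable_cong_sets)
      show "AE x in ssa_sample_law f w lam \<alpha> \<theta>\<^sub>0 n. norm (x - xs) > 0" for n
        unfolding ssa_sample_law_def
        using pos[of n] by (subst AE_bind[OF gk]) (auto elim!: eventually_mono dest: AE_gauss_neq[of _ xs])
      show "(\<integral>\<^sup>+x. ennreal ((norm (x - xs))\<^sup>2) \<partial>ssa_sample_law f w lam \<alpha> \<theta>\<^sub>0 n) \<le> ennreal (\<rho> ^ n * ?L \<theta>\<^sub>0)" for n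
      proof -
        have "(\<integral>\<^sup>+x. ennreal ((norm (x - xs))\<^sup>2) \<partial>ssa_sample_law f w lam \<alpha> \<theta>\<^sub>0 n)
            = (\<integral>\<^sup>+\<theta>. \<integral>\<^sup>+x. ennreal ((norm (x - xs))\<^sup>2) \<partial>gauss \<theta> \<partial>?M n)"
          unfolding ssa_sample_law_def by (rule nn_integral_bind[OF _ gk]) measurable
        also have "\<dots> \<le> (\<integral>\<^sup>+\<theta>. ennreal (?L \<theta>) \<partial>?M n)"
        proof (intro nn_integral_mono_AE)
          show "AE \<theta> in ?M n. (\<integral>\<^sup>+x. ennreal ((norm (x - xs))\<^sup>2) \<partial>gauss \<theta>) \<le> ennreal (?L \<theta>)"
            using pos[of n] by eventually_elim (simp only: gauss_norm_square ennreal_leI V_le)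
        qed
        also note le[of n]
        finally show ?thesis .
      qed
    qed (use L0 \<rho> in auto)
  qed (use \<alpha>\<^sub>0 in auto)
qed

end
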